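(* Let $\mu$ be a distribution on $\Sigma\times\Gamma\times\Phi$ (finite sets), $\Sigma'\subseteq\Sigma$, and $T:\mathsf{supp}(\mu)\to\mathbb{D}$ nonembeddable over $\mathbb{D}$, such that $(\mu,\Sigma',T)$ satisfies the relaxed base case. Then there are constants $c=c(T,\mu)>0$ and $C=C(T,\mu)>0$ such that for all $n$, $d$, all $G:\Gamma^n\to\mathbb{C}$, $H:\Phi^n\to\mathbb{C}$, and every $F:\Sigma^n\to\mathbb{C}$ that is effectively homogeneous of effective degree $d$, $$\left|\mathbb{E}_{(x,y,z)\sim\mu^{\otimes n}}\Big[F(x)G(y)H(z)\prod_{i=1}^nT(x_i,y_i,z_i)\Big]\right|\le 2^{-c\cdot d(d/n)^C}\|F\|_2\|G\|_2\|H\|_2.$$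
   Context: $\mathbb{D}$ is the closed unit disk. $T$ is nonembeddable over $\mathbb{D}$ if there are no $A:\Sigma\to\mathbb{D}$, $B:\Gamma\to\mathbb{D}$, $C:\Phi\to\mathbb{D}$ with $A(x)B(y)C(z)T(x,y,z)=1$ on $\mathsf{supp}(\mu)$. Norms are $L_2$ norms with respect to the marginals $\mu_x^{\otimes n},\mu_y^{\otimes n},\mu_z^{\otimes n}$ (resp. $\mu_x,\mu_y,\mu_z$ for $n=1$). Let $M=\max\{|\Sigma|,|\Gamma|,|\Phi|\}$. For $F:\Sigma\to\mathbb{C}$ put $I_{\mathsf{eff}}[F]=\mathbb{E}_{x,x'\sim\mu_x\text{ indep.}}[1_{x,x'\in\Sigma'}|F(x)-F(x')|^2]$. $(\mu,\Sigma',T)$ satisfies the relaxed base case if: (i) the marginal $\mu_{y,z}$ is a product distribution; (ii) for $(x,y,z)\in\mathsf{supp}(\mu)$, $(y,z)$ determines $x$; (iii) there is a constant $c_0=c_0(T,\mu)>0$ such that for every $\tau>0$ and all $F:\Sigma\to\mathbb{C}$, $G:\Gamma\to\mathbb{C}$, $H:\Phi\to\mathbb{C}$ with $I_{\mathsf{eff}}[F]\ge\tau\|F\|_2^2$, one has $|\mathbb{E}_{(x,y,z)\sim\mu}[F(x)G(y)H(z)T(x,y,z)]|\le(1-c_0\tau^{100M})\|F\|_2\|G\|_2\|H\|_2$. Effective degree: take an orthonormal basis $B=B_1\cup B_2$ of $L_2(\Sigma,\mu_x)$ where $B_1$ is an orthonormal basis of the functions constant on $\Sigma'$ and contains the constant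 function, and $B_2$ is an orthonormal basis of the functions supported on $\Sigma'$ orthogonal to constants. For $\chi=\chi_1\otimes\cdots\otimes\chi_n\in B^{\otimes n}$, $\mathsf{effdeg}(\chi)=|\{i:\chi_i\in B_2\}|$. $F:\Sigma^n\to\mathbb{C}$ is effectively homogeneous of effective degree $d$ if $F=\sum_{\chi\in B^{\otimes n}:\,\mathsf{effdeg}(\chi)=d}\hat F(\chi)\chi$. *)

theory Defs
  imports "HOL-Analysis.Analysis"
begin

text \<open>A distribution mu on Sigma x Gamma x Phi is a function into the nonnegative reals summing to 1.
  Sigma, Gamma, Phi are finite types 'a, 'b, 'c; Sigma' is a set S of type 'a set.
  Elements of Sigma^n are lists of length n.\<close>

definition supp :: "('a \<times> 'b \<times> 'c \<Rightarrow> real) \<Rightarrow> ('a \<times> 'b \<times> 'c) set" where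
  "supp \<mu> = {t. \<mu> t > 0}"

definition margx :: "('a \<times> 'b::finite \<times> 'c::finite \<Rightarrow> real) \<Rightarrow> 'a \<Rightarrow> real" where
  "margx \<mu> x = (\<Sum>y\<in>UNIV. \<Sum>z\<in>UNIV. \<mu> (x, y, z))"

definition margy :: "('a::finite \<times> 'b \<times> 'c::finite \<Rightarrow> real) \<Rightarrow> 'b \<Rightarrow> real" where
  "margy \<mu> y = (\<Sum>x\<in>UNIV. \<Sum>z\<in>UNIV. \<mu> (x, y, z))"

definition margz :: "('a::finite \<times> 'b::finite \<times> 'c \<Rightarrow> real) \<Rightarrow> 'c \<Rightarrow> real" where
  "margz \<mu> z = (\<Sum>x\<in>UNIV. \<Sum>y\<in>UNIV. \<mu> (x, y, z))"

definition margyz :: "('a::finite \<times> 'b \<times> 'c \<Rightarrow> real) \<Rightarrow> 'b \<Rightarrow> 'c \<Rightarrow> real" where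
  "margyz \<mu> y z = (\<Sum>x\<in>UNIV. \<mu> (x, y, z))"

definition nrm1 :: "('a::finite \<Rightarrow> real) \<Rightarrow> ('a \<Rightarrow> complex) \<Rightarrow> real" where
  "nrm1 p f = sqrt (\<Sum>a\<in>UNIV. p a * (cmod (f a))\<^sup>2)"

definition nrm :: "('a::finite \<Rightarrow> real) \<Rightarrow> nat \<Rightarrow> ('a list \<Rightarrow> complex) \<Rightarrow> real" where
  "nrm p n F = sqrt (\<Sum>xs\<in>{xs. length xs = n}. prod_list (map p xs) * (cmod (F xs))\<^sup>2)"

definition corr1 :: "('a::finite \<times> 'b::finite \<times> 'c::finite \<Rightarrow> real) \<Rightarrow> ('a \<Rightarrow> complex) \<Rightarrow> ('b \<Rightarrow> complex)
    \<Rightarrow> ('c \<Rightarrow> complex) \<Rightarrow> ('a \<Rightarrow> 'b \<Rightarrow> 'c \<Rightarrow> complex) \<Rightarrow> complex" where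
  "corr1 \<mu> f g h T = (\<Sum>(x, y, z)\<in>UNIV. complex_of_real (\<mu> (x, y, z)) * f x * g y * h z * T x y z)"

definition corr :: "('a::finite \<times> 'b::finite \<times> 'c::finite \<Rightarrow> real) \<Rightarrow> nat \<Rightarrow> ('a list \<Rightarrow> complex)
    \<Rightarrow> ('b list \<Rightarrow> complex) \<Rightarrow> ('c list \<Rightarrow> complex) \<Rightarrow> ('a \<Rightarrow> 'b \<Rightarrow> 'c \<Rightarrow> complex) \<Rightarrow> complex" where
  "corr \<mu> n F G H T = (\<Sum>w\<in>{w. length w = n}.
      complex_of_real (prod_list (map \<mu> w)) * F (map fst w) * G (map (fst \<circ> snd) w)
      * H (map (snd \<circ> snd) w) * prod_list (map (\<lambda>(x, y, z). T x y z) w))"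

definition ieff :: "('a::finite \<Rightarrow> real) \<Rightarrow> 'a set \<Rightarrow> ('a \<Rightarrow> complex) \<Rightarrow> real" where
  "ieff p S f = (\<Sum>x\<in>UNIV. \<Sum>x'\<in>UNIV.
      if x \<in> S \<and> x' \<in> S then p x * p x' * (cmod (f x - f x'))\<^sup>2 else 0)"

definition nonembeddable :: "('a \<times> 'b \<times> 'c \<Rightarrow> real) \<Rightarrow> ('a \<Rightarrow> 'b \<Rightarrow> 'c \<Rightarrow> complex) \<Rightarrow> bool" where
  "nonembeddable \<mu> T \<longleftrightarrow> \<not> (\<exists>A B C. (\<forall>x. cmod (A x) \<le> 1) \<and> (\<forall>y. cmod (B y) \<le> 1) \<and> (\<forall>z. cmod (C z) \<le> 1)
      \<and> (\<forall>x y z. (x, y, z) \<in> supp \<mu> \<longrightarrow> A x * B y * C z * T x y z = 1))"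

definition relaxed_base_case :: "('a::finite \<times> 'b::finite \<times> 'c::finite \<Rightarrow> real) \<Rightarrow> 'a set
    \<Rightarrow> ('a \<Rightarrow> 'b \<Rightarrow> 'c \<Rightarrow> complex) \<Rightarrow> bool" where
  "relaxed_base_case \<mu> S T \<longleftrightarrow>
     (\<forall>y z. margyz \<mu> y z = margy \<mu> y * margz \<mu> z) \<and>
     (\<forall>x x' y z. (x, y, z) \<in> supp \<mu> \<and> (x', y, z) \<in> supp \<mu> \<longrightarrow> x = x') \<and>
     (\<exists>c0>0. \<forall>\<tau>>0. \<forall>f g h. ieff (margx \<mu>) S f \<ge> \<tau> * (nrm1 (margx \<mu>) f)\<^sup>2 \<longrightarrow>
        cmod (corr1 \<mu> f g h T) \<le> (1 - c0 * \<tau> ^ (100 * max CARD('a) (max CARD('b) CARD('c))))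
          * nrm1 (margx \<mu>) f * nrm1 (margy \<mu>) g * nrm1 (margz \<mu>) h)"

text \<open>Orthonormal bases of subspaces of L2(Sigma, p); equality in L2 is equality p-almost everywhere.\<close>
definition ipx :: "('a::finite \<Rightarrow> real) \<Rightarrow> ('a \<Rightarrow> complex) \<Rightarrow> ('a \<Rightarrow> complex) \<Rightarrow> complex" where
  "ipx p f g = (\<Sum>a\<in>UNIV. complex_of_real (p a) * f a * cnj (g a))"

definition orthonormal_fam :: "('a::finite \<Rightarrow> real) \<Rightarrow> ('a \<Rightarrow> complex) set \<Rightarrow> bool" where
  "orthonormal_fam p B \<longleftrightarrow> (\<forall>f\<in>B. ipx p f f = 1) \<and> (\<forall>f\<in>B. \<forall>g\<in>B. f \<noteq> g \<longrightarrow> ipx p f g = 0)"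

definition ae_eq :: "('a \<Rightarrow> real) \<Rightarrow> ('a \<Rightarrow> complex) \<Rightarrow> ('a \<Rightarrow> complex) \<Rightarrow> bool" where
  "ae_eq p f g \<longleftrightarrow> (\<forall>a. p a > 0 \<longrightarrow> f a = g a)"

definition onb_of :: "('a::finite \<Rightarrow> real) \<Rightarrow> ('a \<Rightarrow> complex) set \<Rightarrow> ('a \<Rightarrow> complex) set \<Rightarrow> bool" where
  "onb_of p V B \<longleftrightarrow> B \<subseteq> V \<and> finite B \<and> orthonormal_fam p B \<and>
     (\<forall>f\<in>V. \<exists>coef. ae_eq p f (\<lambda>a. \<Sum>b\<in>B. coef b * b a))"

definition const_on :: "'a set \<Rightarrow> ('a \<Rightarrow> complex) set" where
  "const_on S = {f. \<forall>a\<in>S. \<forall>a'\<in>S. f a = f a'}"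

definition supp_on_perp_const :: "('a::finite \<Rightarrow> real) \<Rightarrow> 'a set \<Rightarrow> ('a \<Rightarrow> complex) set" where
  "supp_on_perp_const p S = {f. (\<forall>a. a \<notin> S \<longrightarrow> f a = 0) \<and> ipx p f (\<lambda>_. 1) = 0}"

definition eff_basis :: "('a::finite \<Rightarrow> real) \<Rightarrow> 'a set \<Rightarrow> ('a \<Rightarrow> complex) set \<Rightarrow> ('a \<Rightarrow> complex) set \<Rightarrow> bool" where
  "eff_basis p S B1 B2 \<longleftrightarrow> onb_of p (const_on S) B1 \<and> (\<lambda>_. 1) \<in> B1 \<and>
     onb_of p (supp_on_perp_const p S) B2 \<and> onb_of p UNIV (B1 \<union> B2)"

text \<open>chi in B^{\<otimes>n} is a list of n basis functions; effdeg chi = number of positions in B2.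
  F = sum of coefficients times chi, as an identity in L2(p^{\<otimes>n}).\<close>
definition effdeg :: "('a \<Rightarrow> complex) set \<Rightarrow> ('a \<Rightarrow> complex) list \<Rightarrow> nat" where
  "effdeg B2 ch = card {i. i < length ch \<and> ch ! i \<in> B2}"

definition tensor :: "('a \<Rightarrow> complex) list \<Rightarrow> 'a list \<Rightarrow> complex" where
  "tensor ch xs = prod_list (map2 (\<lambda>f a. f a) ch xs)"

definition eff_homog :: "('a::finite \<Rightarrow> real) \<Rightarrow> ('a \<Rightarrow> complex) set \<Rightarrow> ('a \<Rightarrow> complex) set
    \<Rightarrow> nat \<Rightarrow> nat \<Rightarrow> ('a list \<Rightarrow> complex) \<Rightarrow> bool" where
  "eff_homog p B1 B2 n d F \<longleftrightarrow> (\<exists>coef. \<forall>xs. length xs = n \<and> (\<forall>a\<in>set xs. p a > 0) \<longrightarrow>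
      F xs = (\<Sum>ch\<in>{ch. length ch = n \<and> set ch \<subseteq> B1 \<union> B2 \<and> effdeg B2 ch = d}. coef ch * tensor ch xs))"

end

theory Submission
  imports Defs
begin

text \<open>
  The idea is to peel off one coordinate at a time. Writing \<open>F\<close> through its coefficient vector, some
  coordinate carries effective influence at least of order \<open>d/n\<close>; slicing there exhibits the correlation
  as a one-coordinate correlation of vector-valued functions \<open>f, g, h\<close>, paired through the bilinear
  map \<open>Q\<close> that records the \<open>(n-1)\<close>-dimensional correlations in effective degree at least \<open>d-1\<close>.

  The base case is therefore needed for functions with values in Hilbert spaces and a bilinear contraction
  \<open>Q\<close>. If such a correlation is within \<open>\<epsilon>\<close> of its maximum, then on the support \<open>Q(g y, h z)\<close> is close to
  \<open>cnj (T x y z) f x\<close> and \<open>Q\<close> nearly preserves norms; by polarization it nearly preserves inner products of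
  elementary tensors. Pairing with the fixed vector \<open>Q(g y0, h z0)\<close> hence yields scalar functions that
  nearly attain equality, so the scalar base case makes each pairing \<open>x \<mapsto> \<langle>Q(g y0, h z0), f x\<rangle>\<close> almost
  constant on \<open>S\<close>. As \<open>f x0\<close> itself is such a probe up to a phase, \<open>f\<close> is almost constant on \<open>S\<close>.

  Each of the first \<open>d/2\<close> peeled coordinates gains a factor \<open>1 - c (d/n)^(2N)\<close>.
\<close>

subsection \<open>Weighted inner products and polarization\<close>

lemma cmod_diff_sq: "(cmod (a - b))\<^sup>2 = (cmod a)\<^sup>2 + (cmod b)\<^sup>2 - 2 * Re (a * cnj b)"
  unfolding cmod_power2 by (simp add: power2_eq_square algebra_simps)

lemma cmod_diff_sq_le: "(cmod (a - b))\<^sup>2 \<le> 2 * (cmod a)\<^sup>2 + 2 * (cmod b)\<^sup>2"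
proof -
  have "(cmod (a - b))\<^sup>2 \<le> (cmod a + cmod b)\<^sup>2"
    by (intro power_mono norm_triangle_ineq4) auto
  also have "\<dots> \<le> 2 * (cmod a)\<^sup>2 + 2 * (cmod b)\<^sup>2"
    using sum_squares_bound[of "cmod a" "cmod b"] by (simp add: power2_sum)
  finally show ?thesis .
qed

text \<open>The weight stays explicit because two kinds of vectors occur: functions on words,
  weighted by a product measure, and coefficient vectors, weighted by 1. Weights may vanish, so
  \<open>wsq\<close> is only a seminorm.\<close>

definition wip :: "'j set \<Rightarrow> ('j \<Rightarrow> real) \<Rightarrow> ('j \<Rightarrow> complex) \<Rightarrow> ('j \<Rightarrow> complex) \<Rightarrow> complex" where
  "wip J w u v = (\<Sum>j\<in>J. of_real (w j) * u j * cnj (v j))"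

definition wsq :: "'j set \<Rightarrow> ('j \<Rightarrow> real) \<Rightarrow> ('j \<Rightarrow> complex) \<Rightarrow> real" where
  "wsq J w u = (\<Sum>j\<in>J. w j * (cmod (u j))\<^sup>2)"

lemma wsq_nonneg: "(\<And>j. j \<in> J \<Longrightarrow> 0 \<le> w j) \<Longrightarrow> 0 \<le> wsq J w u"
  unfolding wsq_def by (intro sum_nonneg) auto

lemma wip_self: "wip J w u u = of_real (wsq J w u)"
  unfolding wip_def wsq_def of_real_sum
  by (intro sum.cong) (auto simp: complex_norm_square[symmetric] mult.assoc)

lemma wip_diff_left: "wip J w (\<lambda>j. u j - u' j) v = wip J w u v - wip J w u' v"
  unfolding wip_def by (simp add: algebra_simps sum_subtractf)

lemma wip_diff_right: "wip J w u (\<lambda>j. v j - v' j) = wip J w u v - wip J w u v'"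
  unfolding wip_def by (simp add: algebra_simps sum_subtractf)

lemma wip_scale_right: "wip J w u (\<lambda>j. c * v j) = cnj c * wip J w u v"
  unfolding wip_def sum_distrib_left by (simp add: mult_ac)

lemma wsq_scale: "wsq J w (\<lambda>j. c * u j) = (cmod c)\<^sup>2 * wsq J w u"
  unfolding wsq_def sum_distrib_left by (simp add: norm_mult power_mult_distrib mult_ac)

lemma wip_cauchy_schwarz:
  assumes "\<And>j. j \<in> J \<Longrightarrow> 0 \<le> w j"
  shows "(cmod (wip J w u v))\<^sup>2 \<le> wsq J w u * wsq J w v"
proof -
  have "cmod (wip J w u v) \<le> (\<Sum>j\<in>J. (sqrt (w j) * cmod (u j)) * (sqrt (w j) * cmod (v j)))"
    unfolding wip_def
  proof (rule sum_norm_le)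
    fix j assume "j \<in> J"
    then have "sqrt (w j) * sqrt (w j) = w j" "\<bar>w j\<bar> = w j" using assms by auto
    then show "cmod (of_real (w j) * u j * cnj (v j)) \<le> sqrt (w j) * cmod (u j) * (sqrt (w j) * cmod (v j))"
      by (simp add: norm_mult mult_ac) (simp flip: mult.assoc)
  qed
  then have "(cmod (wip J w u v))\<^sup>2 \<le> (\<Sum>j\<in>J. (sqrt (w j) * cmod (u j)) * (sqrt (w j) * cmod (v j)))\<^sup>2"
    by (rule power_mono) auto
  also have "\<dots> \<le> (\<Sum>j\<in>J. (sqrt (w j) * cmod (u j))\<^sup>2) * (\<Sum>j\<in>J. (sqrt (w j) * cmod (v j))\<^sup>2)"
    by (rule Cauchy_Schwarz_ineq_sum)
  also have "\<dots> = wsq J w u * wsq J w v"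
    unfolding wsq_def using assms by (auto simp: power_mult_distrib intro!: arg_cong2[where f="(*)"] sum.cong)
  finally show ?thesis .
qed

lemma wsq_diff:
  "wsq J w (\<lambda>j. u j - v j) = wsq J w u + wsq J w v - 2 * Re (wip J w u v)"
  unfolding wsq_def wip_def Re_sum cmod_diff_sq
  by (simp only: right_diff_distrib distrib_left sum.distrib sum_subtractf sum_distrib_left)
     (simp add: distrib_left mult_ac)

lemma wsq_diff_le:
  assumes "\<And>j. j \<in> J \<Longrightarrow> 0 \<le> w j"
  shows "wsq J w (\<lambda>j. u j - v j) \<le> 2 * wsq J w u + 2 * wsq J w v"
proof -
  have "wsq J w (\<lambda>j. u j - v j) \<le> (\<Sum>j\<in>J. w j * (2 * (cmod (u j))\<^sup>2 + 2 * (cmod (v j))\<^sup>2))"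
    unfolding wsq_def using assms by (intro sum_mono mult_left_mono cmod_diff_sq_le)
  then show ?thesis
    unfolding wsq_def by (simp add: sum.distrib sum_distrib_left algebra_simps)
qed

section \<open>Polarization over the fourth roots of unity\<close>

abbreviation fourth_roots :: "complex set" where
  "fourth_roots \<equiv> {1, \<i>, -1, -\<i>}"

lemma sum_fourth_roots: "(\<Sum>c\<in>fourth_roots. f c) = f 1 + f \<i> + f (-1) + f (-\<i>)"
  for f :: "complex \<Rightarrow> 'z::ab_group_add"
proof -
  have "distinct [1, \<i>, -1, -\<i>]" by (auto simp: complex_eq_iff)
  then show ?thesis by (simp add: add.assoc)
qed

text \<open>Only the term of the expanded square that contains \<open>cnj c\<close> survives
  multiplication by \<open>c\<close> and summation, since both \<open>c\<close> and
  \<open>c\<^sup>2\<close> sum to zero over the fourth roots of unity.\<close>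

lemma polarization:
  "(\<Sum>c\<in>fourth_roots. c * of_real ((cmod (a + c * b))\<^sup>2)) = 4 * a * cnj b"
  unfolding sum_fourth_roots cmod_power2
  by (simp add: complex_eq_iff power2_eq_square algebra_simps)

lemma sum_fourth_roots_norm:
  "(\<Sum>c\<in>fourth_roots. (cmod (a + c * b))\<^sup>2) = 4 * ((cmod a)\<^sup>2 + (cmod b)\<^sup>2)"
  unfolding sum_fourth_roots cmod_power2
  by (simp add: power2_eq_square algebra_simps)

text \<open>Every product other than \<open>p * cnj s\<close> keeps a nontrivial power of
  \<open>d\<close> and cancels. This polarizes in the second argument of \<open>Q\<close> once
  \<open>wsq_polarization\<close> has treated the first.\<close>

lemma sesqui_polarization:
  "(\<Sum>d\<in>fourth_roots. d * ((p + d * q) * cnj (r + d * s))) = 4 * p * cnj s"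
  unfolding sum_fourth_roots by (simp add: algebra_simps)

lemma wsq_polarization:
  "(\<Sum>c\<in>fourth_roots. c * of_real (wsq J w (\<lambda>j. u j + c * v j))) = 4 * wip J w u v"
proof -
  have "(\<Sum>c\<in>fourth_roots. c * of_real (wsq J w (\<lambda>j. u j + c * v j)))
      = (\<Sum>c\<in>fourth_roots. \<Sum>j\<in>J. of_real (w j) * (c * of_real ((cmod (u j + c * v j))\<^sup>2)))"
    unfolding wsq_def by (simp add: sum_distrib_left mult_ac)
  also have "\<dots> = (\<Sum>j\<in>J. of_real (w j) * (\<Sum>c\<in>fourth_roots. c * of_real ((cmod (u j + c * v j))\<^sup>2)))"
    by (subst sum.swap) (simp only: sum_distrib_left)
  also have "\<dots> = 4 * wip J w u v"
    unfolding polarization wip_def by (simp add: sum_distrib_left mult_ac)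
  finally show ?thesis .
qed

lemma wsq_sum_fourth_roots:
  "(\<Sum>c\<in>fourth_roots. wsq J w (\<lambda>j. u j + c * v j)) = 4 * (wsq J w u + wsq J w v)"
proof -
  have "(\<Sum>c\<in>fourth_roots. wsq J w (\<lambda>j. u j + c * v j))
      = (\<Sum>j\<in>J. w j * (\<Sum>c\<in>fourth_roots. (cmod (u j + c * v j))\<^sup>2))"
    unfolding wsq_def by (subst sum.swap) (simp only: sum_distrib_left)
  then show ?thesis
    unfolding sum_fourth_roots_norm wsq_def by (simp add: sum_distrib_left sum.distrib algebra_simps)
qed

text \<open>The deficit \<open>|v|\<^sup>2|w|\<^sup>2 - |Q(v,w)|\<^sup>2\<close> is a nonnegative biquadratic form, so polarizing in both
  arguments bounds its off-diagonal values by the diagonal ones, without any Cauchy-Schwarz step.\<close>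

lemma bilinear_contraction_almost_tensor:
  fixes Q :: "('j \<Rightarrow> complex) \<Rightarrow> ('k \<Rightarrow> complex) \<Rightarrow> 'i \<Rightarrow> complex"
  assumes lin1: "\<And>v v' c w i. Q (\<lambda>j. v j + c * v' j) w i = Q v w i + c * Q v' w i"
    and lin2: "\<And>v w w' c i. Q v (\<lambda>k. w k + c * w' k) i = Q v w i + c * Q v w' i"
    and contr: "\<And>v w. wsq I wI (Q v w) \<le> wsq J wJ v * wsq K wK w"
  defines "D \<equiv> \<lambda>v w. wsq J wJ v * wsq K wK w - wsq I wI (Q v w)"
  shows "cmod (wip I wI (Q v1 w1) (Q v2 w2) - wip J wJ v1 v2 * wip K wK w1 w2)
    \<le> D v1 w1 + D v1 w2 + D v2 w1 + D v2 w2"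
proof -
  let ?v = "\<lambda>c j. v1 j + c * v2 j" and ?w = "\<lambda>d k. w1 k + d * w2 k"
  let ?R = fourth_roots
  have Q: "Q (?v c) (?w d) = (\<lambda>i. (Q v1 w1 i + d * Q v1 w2 i) + c * (Q v2 w1 i + d * Q v2 w2 i))" for c d
    by (rule ext) (simp add: lin1 lin2)
  have Qpol: "(\<Sum>d\<in>?R. d * (\<Sum>c\<in>?R. c * of_real (wsq I wI (Q (?v c) (?w d))))) = 16 * wip I wI (Q v1 w1) (Q v2 w2)"
  proof -
    have "(\<Sum>d\<in>?R. d * (\<Sum>c\<in>?R. c * of_real (wsq I wI (Q (?v c) (?w d)))))
       = 4 * (\<Sum>d\<in>?R. d * wip I wI (\<lambda>i. Q v1 w1 i + d * Q v1 w2 i) (\<lambda>i. Q v2 w1 i + d * Q v2 w2 i))"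
      unfolding Q wsq_polarization by (simp only: sum_distrib_left mult_ac)
    also have "\<dots> = 4 * (\<Sum>i\<in>I. of_real (wI i) * (\<Sum>d\<in>?R. d * ((Q v1 w1 i + d * Q v1 w2 i) * cnj (Q v2 w1 i + d * Q v2 w2 i))))"
      unfolding wip_def by (simp only: sum_distrib_left, subst sum.swap, simp only: mult_ac)
    also have "\<dots> = 16 * wip I wI (Q v1 w1) (Q v2 w2)"
      unfolding sesqui_polarization wip_def by (simp add: sum_distrib_left mult_ac)
    finally show ?thesis .
  qed
  have Npol: "(\<Sum>d\<in>?R. d * (\<Sum>c\<in>?R. c * of_real (wsq J wJ (?v c) * wsq K wK (?w d)))) = 16 * (wip J wJ v1 v2 * wip K wK w1 w2)"
  proof -
    have "(\<Sum>d\<in>?R. d * (\<Sum>c\<in>?R. c * of_real (wsq J wJ (?v c) * wsq K wK (?w d))))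
      = (\<Sum>c\<in>?R. c * of_real (wsq J wJ (?v c))) * (\<Sum>d\<in>?R. d * of_real (wsq K wK (?w d)))"
      unfolding of_real_mult sum_product by (subst sum.swap) (simp only: sum_distrib_left mult_ac)
    then show ?thesis unfolding wsq_polarization by simp
  qed
  have Qsum: "(\<Sum>d\<in>?R. \<Sum>c\<in>?R. wsq I wI (Q (?v c) (?w d)))
     = 16 * (wsq I wI (Q v1 w1) + wsq I wI (Q v1 w2) + wsq I wI (Q v2 w1) + wsq I wI (Q v2 w2))"
    unfolding Q wsq_sum_fourth_roots sum.distrib
    by (simp only: sum_distrib_left[symmetric] sum.distrib wsq_sum_fourth_roots) (simp add: algebra_simps)
  have Nsum: "(\<Sum>d\<in>?R. \<Sum>c\<in>?R. wsq J wJ (?v c) * wsq K wK (?w d))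
     = 16 * ((wsq J wJ v1 + wsq J wJ v2) * (wsq K wK w1 + wsq K wK w2))"
    by (simp only: sum_distrib_left[symmetric] sum_distrib_right[symmetric] wsq_sum_fourth_roots)
  have cm: "cmod c = 1" if "c \<in> ?R" for c using that by auto
  have "16 * (wip I wI (Q v1 w1) (Q v2 w2) - wip J wJ v1 v2 * wip K wK w1 w2)
     = (\<Sum>d\<in>?R. \<Sum>c\<in>?R. d * c * of_real (- D (?v c) (?w d)))"
    unfolding right_diff_distrib Qpol[symmetric] Npol[symmetric] D_def
    by (simp add: sum_subtractf[symmetric] sum_distrib_left algebra_simps)
  then have "16 * cmod (wip I wI (Q v1 w1) (Q v2 w2) - wip J wJ v1 v2 * wip K wK w1 w2)
     = cmod (\<Sum>d\<in>?R. \<Sum>c\<in>?R. d * c * of_real (- D (?v c) (?w d)))"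
    by (metis norm_mult norm_numeral)
  also have "\<dots> \<le> (\<Sum>d\<in>?R. \<Sum>c\<in>?R. D (?v c) (?w d))"
  proof (intro sum_norm_le)
    fix c d assume "d \<in> ?R" "c \<in> ?R"
    then have "cmod (d * c * of_real (- D (?v c) (?w d))) = \<bar>- D (?v c) (?w d)\<bar>"
      by (simp only: norm_mult cm norm_of_real mult_1)
    then show "cmod (d * c * of_real (- D (?v c) (?w d))) \<le> D (?v c) (?w d)"
      using contr by (simp add: D_def)
  qed
  also have "\<dots> = 16 * (D v1 w1 + D v1 w2 + D v2 w1 + D v2 w2)"
    unfolding D_def sum_subtractf Qsum Nsum by (simp add: algebra_simps)
  finally show ?thesis by simp
qed

subsection \<open>The scalar base case\<close>

text \<open>\<open>A\<close> dominates the reciprocals of the positive masses, which turns small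
  averages into pointwise bounds on the support. With \<open>N\<close> and \<open>c0\<close> as
  parameters, all later constants are explicit in them.\<close>

locale relaxed_base =
  fixes \<mu> :: "'a::finite \<times> 'b::finite \<times> 'c::finite \<Rightarrow> real"
    and S :: "'a set"
    and T :: "'a \<Rightarrow> 'b \<Rightarrow> 'c \<Rightarrow> complex"
    and N :: nat and c0 A :: real
  assumes mu_nonneg: "\<mu> t \<ge> 0"
    and mu_sum: "(\<Sum>t\<in>UNIV. \<mu> t) = 1"
    and T_le: "\<mu> (x, y, z) > 0 \<Longrightarrow> cmod (T x y z) \<le> 1"
    and yz_indep: "margyz \<mu> y z = margy \<mu> y * margz \<mu> z"
    and N_pos: "N > 0" and c0_pos: "c0 > 0"
    and mu_min: "\<mu> t > 0 \<Longrightarrow> 1 \<le> A * \<mu> t"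
    and scalar_base: "\<tau> > 0 \<Longrightarrow> \<tau> * (nrm1 (margx \<mu>) f)\<^sup>2 \<le> ieff (margx \<mu>) S f \<Longrightarrow>
        cmod (corr1 \<mu> f g h T) \<le> (1 - c0 * \<tau> ^ N) * nrm1 (margx \<mu>) f * nrm1 (margy \<mu>) g * nrm1 (margz \<mu>) h"
begin

abbreviation "p \<equiv> margx \<mu>"
abbreviation "q \<equiv> margy \<mu>"
abbreviation "r \<equiv> margz \<mu>"

lemma sum_triple: "(\<Sum>(x, y, z)\<in>UNIV. k x y z) = (\<Sum>x\<in>UNIV. \<Sum>y\<in>UNIV. \<Sum>z\<in>UNIV. k x y z)"
  for k :: "'a \<Rightarrow> 'b \<Rightarrow> 'c \<Rightarrow> 'z::comm_monoid_add"
  by (simp add: sum.cartesian_product UNIV_Times_UNIV[symmetric] del: UNIV_Times_UNIV)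

lemma expect_x: "(\<Sum>(x, y, z)\<in>UNIV. \<mu> (x, y, z) * \<phi> x) = (\<Sum>x\<in>UNIV. p x * \<phi> x)"
  unfolding sum_triple margx_def by (simp add: sum_distrib_right)

text \<open>Independence of \<open>y\<close> and \<open>z\<close> makes the mean square of a product
  \<open>G y * H z\<close> equal to the product of the two squared norms.\<close>

lemma expect_yz: "(\<Sum>(x, y, z)\<in>UNIV. \<mu> (x, y, z) * (\<phi> y * \<psi> z)) = (\<Sum>y\<in>UNIV. q y * \<phi> y) * (\<Sum>z\<in>UNIV. r z * \<psi> z)"
proof -
  have "(\<Sum>(x, y, z)\<in>UNIV. \<mu> (x, y, z) * (\<phi> y * \<psi> z)) = (\<Sum>y\<in>UNIV. \<Sum>x\<in>UNIV. \<Sum>z\<in>UNIV. \<mu> (x, y, z) * (\<phi> y * \<psi> z))"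
    unfolding sum_triple by (rule sum.swap)
  also have "\<dots> = (\<Sum>y\<in>UNIV. \<Sum>z\<in>UNIV. \<Sum>x\<in>UNIV. \<mu> (x, y, z) * (\<phi> y * \<psi> z))"
    by (intro sum.cong refl sum.swap)
  also have "\<dots> = (\<Sum>y\<in>UNIV. \<Sum>z\<in>UNIV. margyz \<mu> y z * (\<phi> y * \<psi> z))"
    unfolding margyz_def by (simp add: sum_distrib_right)
  also have "\<dots> = (\<Sum>y\<in>UNIV. q y * \<phi> y) * (\<Sum>z\<in>UNIV. r z * \<psi> z)"
    unfolding yz_indep sum_product by (simp add: mult_ac)
  finally show ?thesis .
qed

lemma marg_nonneg: "0 \<le> p x" "0 \<le> q y" "0 \<le> r z"
  unfolding margx_def margy_def margz_def by (auto intro!: sum_nonneg mu_nonneg)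

lemma sum_p: "(\<Sum>x\<in>UNIV. p x) = 1"
  using expect_x[of "\<lambda>_. 1"] mu_sum by (simp add: case_prod_unfold)

lemma mu_le_marg: "\<mu> (x, y, z) \<le> p x" "\<mu> (x, y, z) \<le> q y" "\<mu> (x, y, z) \<le> r z"
proof -
  have two: "k a b \<le> (\<Sum>a\<in>UNIV. \<Sum>b\<in>UNIV. k a b)" if "\<And>a b. 0 \<le> k a b"
    for k :: "'u::finite \<Rightarrow> 'v::finite \<Rightarrow> real" and a b
    by (rule order_trans[OF member_le_sum[of b UNIV "k a"] member_le_sum[of a UNIV "\<lambda>a. \<Sum>b\<in>UNIV. k a b"]])
       (auto intro: that sum_nonneg)
  show "\<mu> (x, y, z) \<le> p x" "\<mu> (x, y, z) \<le> q y" "\<mu> (x, y, z) \<le> r z"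
    unfolding margx_def margy_def margz_def
    using two[of "\<lambda>y z. \<mu> (x, y, z)" y z] two[of "\<lambda>x z. \<mu> (x, y, z)" x z] two[of "\<lambda>x y. \<mu> (x, y, z)" x y]
    by (auto simp: mu_nonneg)
qed

lemma A_ge_1: "1 \<le> A"
proof -
  obtain t where t: "\<mu> t > 0"
    using mu_sum mu_nonneg by (metis less_eq_real_def sum.neutral zero_neq_one)
  have "\<mu> t \<le> 1"
    using member_le_sum[of t UNIV \<mu>] mu_nonneg mu_sum by auto
  then have "1 * \<mu> t \<le> A * \<mu> t" using mu_min[OF t] by linarith
  then show ?thesis using t by (rule mult_right_le_imp_le)
qed

lemma marg_min:
  assumes "\<mu> (x, y, z) > 0"
  shows "1 \<le> A * p x" "1 \<le> A * q y" "1 \<le> A * r z"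
proof -
  have *: "1 \<le> A * m" if "\<mu> (x, y, z) \<le> m" for m
    using mu_min[OF assms] mult_left_mono[OF that, of A] A_ge_1 by linarith
  show "1 \<le> A * p x" "1 \<le> A * q y" "1 \<le> A * r z"
    by (intro * mu_le_marg)+
qed

lemma p_pos_supp: "p x > 0 \<Longrightarrow> \<exists>y z. \<mu> (x, y, z) > 0"
  unfolding margx_def by (rule ccontr) (simp add: not_less order_antisym[OF _ mu_nonneg])

text \<open>Every atom has mass at least \<open>1 / A\<close>, so on the support a nonnegative
  quantity exceeds its average by at most the factor \<open>A\<close>.\<close>

lemma point_le_expect:
  assumes "\<And>x y z. \<mu> (x, y, z) > 0 \<Longrightarrow> 0 \<le> \<theta> x y z"
    and "(\<Sum>(x, y, z)\<in>UNIV. \<mu> (x, y, z) * \<theta> x y z) \<le> e"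
    and "\<mu> (x, y, z) > 0"
  shows "\<theta> x y z \<le> A * e"
proof -
  have nn: "0 \<le> \<mu> (x, y, z) * \<theta> x y z" for x y z
    using assms(1)[of x y z] mu_nonneg[of "(x, y, z)"] by (cases "\<mu> (x, y, z) = 0") auto
  have "\<mu> (x, y, z) * \<theta> x y z \<le> (\<Sum>(x, y, z)\<in>UNIV. \<mu> (x, y, z) * \<theta> x y z)"
    using member_le_sum[of "(x, y, z)" UNIV "\<lambda>(x, y, z). \<mu> (x, y, z) * \<theta> x y z"] nn by auto
  with assms(2) have "\<mu> (x, y, z) * \<theta> x y z \<le> e" by linarith
  then have "A * (\<mu> (x, y, z) * \<theta> x y z) \<le> A * e" using A_ge_1 by (intro mult_left_mono) auto
  moreover have "1 * \<theta> x y z \<le> (A * \<mu> (x, y, z)) * \<theta> x y z"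
    using mu_min assms by (intro mult_right_mono) auto
  ultimately show ?thesis by (simp add: mult.assoc)
qed

lemma nrm1_sq: "(\<And>a. 0 \<le> w a) \<Longrightarrow> (nrm1 w f)\<^sup>2 = (\<Sum>a\<in>UNIV. w a * (cmod (f a))\<^sup>2)"
  unfolding nrm1_def by (intro real_sqrt_pow2 sum_nonneg) auto

lemma nrm1_nonneg: "(\<And>a. 0 \<le> w a) \<Longrightarrow> 0 \<le> nrm1 w f"
  unfolding nrm1_def by (intro real_sqrt_ge_zero sum_nonneg) auto

lemma ieff_nonneg: "0 \<le> ieff p S f"
  unfolding ieff_def by (intro sum_nonneg) (auto simp: marg_nonneg)

lemma ieff_le: "ieff p S f \<le> 4 * (nrm1 p f)\<^sup>2"
proof -
  have "ieff p S f \<le> (\<Sum>x\<in>UNIV. \<Sum>x'\<in>UNIV. p x * p x' * (2 * (cmod (f x))\<^sup>2 + 2 * (cmod (f x'))\<^sup>2))"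
    unfolding ieff_def by (intro sum_mono) (auto simp: marg_nonneg intro!: mult_left_mono cmod_diff_sq_le)
  also have "\<dots> = (\<Sum>x\<in>UNIV. \<Sum>x'\<in>UNIV. (2 * (p x * (cmod (f x))\<^sup>2)) * p x') + (\<Sum>x\<in>UNIV. \<Sum>x'\<in>UNIV. p x * (2 * (p x' * (cmod (f x'))\<^sup>2)))"
    by (simp only: distrib_left sum.distrib) (simp add: mult_ac)
  also have "\<dots> = 4 * (nrm1 p f)\<^sup>2"
    by (simp only: sum_distrib_left[symmetric] sum_distrib_right[symmetric] sum_p nrm1_sq[OF marg_nonneg(1)])
  finally show ?thesis .
qed

text \<open>The averaged defect equals \<open>\<phi>\<^sup>2 + \<gamma>\<^sup>2 - 2 * Re co\<close>,
  where \<open>co\<close> correlates \<open>F\<close> with the conjugates of \<open>G\<close> and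
  \<open>H\<close>. A small defect pushes the correlation towards its maximum, which the scalar base
  case forbids unless the influence of \<open>F\<close> is small. Norms are not normalized;
  \<open>M\<close> makes the bound uniform.\<close>

lemma scalar_near_extremal:
  assumes \<kappa>: "(\<Sum>(x, y, z)\<in>UNIV. \<mu> (x, y, z) *
      ((cmod (T x y z * F x - G y * H z))\<^sup>2 + (1 - (cmod (T x y z))\<^sup>2) * (cmod (F x))\<^sup>2)) \<le> \<kappa>"
    and M: "(nrm1 p F)\<^sup>2 \<le> M"
  shows "ieff p S F ^ N \<le> (16 * (4 * M) ^ (N - 1) + M ^ (N - 1) / c0) * \<kappa>"
proof -
  define \<phi> where "\<phi> = nrm1 p F"
  define \<gamma> where "\<gamma> = nrm1 q G * nrm1 r H"
  define I where "I = ieff p S F"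
  define co where "co = corr1 \<mu> F (\<lambda>y. cnj (G y)) (\<lambda>z. cnj (H z)) T"
  have nn: "0 \<le> \<phi>" "0 \<le> \<gamma>" "0 \<le> I"
    unfolding \<phi>_def \<gamma>_def I_def by (auto intro!: nrm1_nonneg marg_nonneg ieff_nonneg mult_nonneg_nonneg)
  have M0: "0 \<le> M" using M by (rule order_trans[rotated]) simp
  have cnj_nrm: "nrm1 w (\<lambda>y. cnj (G y)) = nrm1 w G" for w and G :: "'u::finite \<Rightarrow> complex" unfolding nrm1_def by simp
  have point: "(cmod (T x y z * F x - G y * H z))\<^sup>2 + (1 - (cmod (T x y z))\<^sup>2) * (cmod (F x))\<^sup>2
     = (cmod (F x))\<^sup>2 + ((cmod (G y))\<^sup>2 * (cmod (H z))\<^sup>2) - 2 * Re (F x * cnj (G y) * cnj (H z) * T x y z)" for x y z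
    unfolding cmod_diff_sq by (simp add: norm_mult power_mult_distrib algebra_simps)
  have "(\<Sum>(x, y, z)\<in>UNIV. \<mu> (x, y, z) *
      ((cmod (T x y z * F x - G y * H z))\<^sup>2 + (1 - (cmod (T x y z))\<^sup>2) * (cmod (F x))\<^sup>2))
     = (\<Sum>(x, y, z)\<in>UNIV. \<mu> (x, y, z) * (cmod (F x))\<^sup>2)
       + (\<Sum>(x, y, z)\<in>UNIV. \<mu> (x, y, z) * ((cmod (G y))\<^sup>2 * (cmod (H z))\<^sup>2)) - 2 * Re co"
    unfolding point co_def corr1_def Re_sum sum_distrib_left sum.distrib[symmetric] sum_subtractf[symmetric]
    by (intro sum.cong refl) (auto simp: algebra_simps)
  also have "\<dots> = \<phi>\<^sup>2 + \<gamma>\<^sup>2 - 2 * Re co"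
    unfolding expect_x expect_yz \<phi>_def \<gamma>_def power_mult_distrib by (simp add: nrm1_sq marg_nonneg)
  finally have main: "\<phi>\<^sup>2 + \<gamma>\<^sup>2 - 2 * Re co \<le> \<kappa>" using \<kappa> by simp
  have I4: "I \<le> 4 * \<phi>\<^sup>2" unfolding I_def \<phi>_def by (rule ieff_le)
  have \<kappa>0: "0 \<le> \<kappa>"
  proof -
    have "0 \<le> (\<Sum>(x, y, z)\<in>UNIV. \<mu> (x, y, z) *
      ((cmod (T x y z * F x - G y * H z))\<^sup>2 + (1 - (cmod (T x y z))\<^sup>2) * (cmod (F x))\<^sup>2))"
    proof (intro sum_nonneg, clarify)
      fix x y z
      show "0 \<le> \<mu> (x, y, z) * ((cmod (T x y z * F x - G y * H z))\<^sup>2 + (1 - (cmod (T x y z))\<^sup>2) * (cmod (F x))\<^sup>2)"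
        using T_le[of x y z] mu_nonneg[of "(x, y, z)"]
        by (cases "\<mu> (x, y, z) = 0") (auto intro!: mult_nonneg_nonneg add_nonneg_nonneg simp: power_le_one)
    qed
    then show ?thesis using \<kappa> by linarith
  qed
  have goal: "I ^ N \<le> 16 * (4 * M) ^ (N - 1) * \<kappa> \<or> I ^ N \<le> M ^ (N - 1) / c0 * \<kappa>"
  proof (cases "I = 0")
    case True
    then show ?thesis using N_pos M0 \<kappa>0 by (simp add: zero_power)
  next
    case False
    with nn have I: "I > 0" by simp
    have \<phi>: "\<phi> > 0" using I I4 nn by (cases "\<phi> = 0") auto
    \<comment> \<open>The largest parameter that \<open>scalar_base\<close> accepts for
      \<open>F\<close>.\<close>
    define \<tau> where "\<tau> = I / \<phi>\<^sup>2"
    have \<tau>: "\<tau> > 0" "\<tau> * \<phi>\<^sup>2 = I" using I \<phi> by (auto simp: \<tau>_def)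
    have "cmod co \<le> (1 - c0 * \<tau> ^ N) * \<phi> * \<gamma>"
      using scalar_base[OF \<tau>(1), of F "\<lambda>y. cnj (G y)" "\<lambda>z. cnj (H z)"] \<tau>(2)
      unfolding co_def \<phi>_def \<gamma>_def I_def by (simp add: cnj_nrm mult.assoc)
    then have "Re co \<le> (1 - c0 * \<tau> ^ N) * \<phi> * \<gamma>" using complex_Re_le_cmod order_trans by blast
    with main have m2: "(\<phi> - \<gamma>)\<^sup>2 + 2 * (c0 * \<tau> ^ N * (\<phi> * \<gamma>)) \<le> \<kappa>"
      by (simp add: power2_eq_square algebra_simps)
    have t0: "0 \<le> c0 * \<tau> ^ N" using c0_pos \<tau> by simp
    show ?thesis
    \<comment> \<open>In the first case \<open>F\<close> is so small that the crude bound
      \<open>I4\<close> suffices. In the second, \<phi> and \<gamma> differ by at most half of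
      \<phi>, so \<open>\<gamma> \<ge> \<phi> / 2\<close> and the gap term of \<open>m2\<close>
      controls \<open>\<tau> ^ N * \<phi>\<^sup>2\<close>.\<close>
    proof (cases "\<phi>\<^sup>2 \<le> 4 * \<kappa>")
      case True
      have "I ^ N = I * I ^ (N - 1)" using N_pos by (subst power_eq_if) simp
      also have "\<dots> \<le> (16 * \<kappa>) * (4 * M) ^ (N - 1)"
        using True I4 I M unfolding \<phi>_def[symmetric] by (intro mult_mono power_mono) auto
      finally show ?thesis by (simp add: mult_ac)
    next
      case False
      have "0 \<le> c0 * \<tau> ^ N * (\<phi> * \<gamma>)" using t0 nn by simp
      with m2 have "(\<phi> - \<gamma>)\<^sup>2 \<le> \<kappa>" by linarith
      with False have "(\<phi> - \<gamma>)\<^sup>2 \<le> (\<phi> / 2)\<^sup>2" by (simp add: power_divide)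
      then have "\<phi> - \<gamma> \<le> \<phi> / 2" by (rule power2_le_imp_le) (use nn in simp)
      then have "\<phi> / 2 \<le> \<gamma>" by simp
      then have "c0 * \<tau> ^ N * (\<phi> * (\<phi> / 2)) \<le> c0 * \<tau> ^ N * (\<phi> * \<gamma>)"
        using t0 nn by (intro mult_left_mono) auto
      with m2 have "c0 * \<tau> ^ N * \<phi>\<^sup>2 \<le> \<kappa>"
        using zero_le_power2[of "\<phi> - \<gamma>"] unfolding power2_eq_square[of \<phi>] by linarith
      then have tt: "\<tau> ^ N * \<phi>\<^sup>2 \<le> \<kappa> / c0" using c0_pos by (simp add: field_simps)
      have "I ^ N = \<tau> ^ N * (\<phi>\<^sup>2) ^ N" by (simp add: \<tau>(2)[symmetric] power_mult_distrib)
      also have "\<dots> = (\<tau> ^ N * \<phi>\<^sup>2) * (\<phi>\<^sup>2) ^ (N - 1)"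
        using N_pos by (subst power_eq_if[of "\<phi>\<^sup>2" N]) simp
      also have "\<dots> \<le> (\<kappa> / c0) * M ^ (N - 1)"
        using tt M \<kappa>0 c0_pos unfolding \<phi>_def[symmetric] by (intro mult_mono power_mono) auto
      finally show ?thesis by (simp add: mult_ac)
    qed
  qed
  moreover have "0 \<le> 16 * (4 * M) ^ (N - 1) * \<kappa>" "0 \<le> M ^ (N - 1) / c0 * \<kappa>"
    using M0 \<kappa>0 c0_pos by auto
  ultimately show ?thesis unfolding I_def distrib_right by linarith
qed

end

subsection \<open>The vector-valued base case\<close>

lemma sum_power_le:
  fixes a b :: real
  assumes "0 \<le> a" "0 \<le> b"
  shows "(a + b) ^ m \<le> 2 ^ m * (a ^ m + b ^ m)"
proof -
  have "(a + b) ^ m \<le> (2 * max a b) ^ m" using assms by (intro power_mono) auto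
  also have "\<dots> = 2 ^ m * (max a b) ^ m" by (simp add: power_mult_distrib)
  also have "\<dots> \<le> 2 ^ m * (a ^ m + b ^ m)" using assms by (intro mult_left_mono) (auto simp: max_def)
  finally show ?thesis .
qed

definition veff :: "('a::finite \<Rightarrow> real) \<Rightarrow> 'a set \<Rightarrow> 'i set \<Rightarrow> ('i \<Rightarrow> real) \<Rightarrow> ('a \<Rightarrow> 'i \<Rightarrow> complex) \<Rightarrow> real" where
  "veff p S I w f = (\<Sum>x\<in>UNIV. \<Sum>x'\<in>UNIV.
     if x \<in> S \<and> x' \<in> S then p x * p x' * wsq I w (\<lambda>i. f x i - f x' i) else 0)"

section \<open>Stability of nearly extremal vector-valued triples\<close>

context relaxed_base
begin

text \<open>The factor of \<open>scalar_near_extremal\<close> at \<open>M = A\<^sup>2\<close>, times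
  the defect \<open>134 * A ^ 3\<close> per unit of \<epsilon> found in
  \<open>probe_ieff\<close>.\<close>

definition const\<^sub>1 :: real where
  "const\<^sub>1 = (16 * (4 * A\<^sup>2) ^ (N - 1) + (A\<^sup>2) ^ (N - 1) / c0) * (134 * A ^ 3)"

text \<open>Collects the two terms of \<open>veff_le\<close> after raising to the power
  \<open>2 * N\<close>.\<close>

definition const\<^sub>2 :: real where
  "const\<^sub>2 = 4 ^ N * ((128 * A\<^sup>2) ^ N + (4 * A\<^sup>2) ^ N * const\<^sub>1)"

lemma const1_nonneg: "0 \<le> const\<^sub>1"
  unfolding const\<^sub>1_def using A_ge_1 c0_pos by (intro mult_nonneg_nonneg add_nonneg_nonneg divide_nonneg_pos) auto

end

text \<open>The norms are normalized and \<epsilon> bounds the gap between the correlation and 1.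
  Since \<open>\<epsilon> \<le> 1\<close>, higher powers of \<epsilon> can be absorbed into
  \<epsilon>.\<close>

locale near_extremal = relaxed_base \<mu> S T N c0 A
  for \<mu> :: "'a::finite \<times> 'b::finite \<times> 'c::finite \<Rightarrow> real"
    and S :: "'a set" and T :: "'a \<Rightarrow> 'b \<Rightarrow> 'c \<Rightarrow> complex" and N :: nat and c0 A :: real +
  fixes I :: "'i set" and wI :: "'i \<Rightarrow> real" and J :: "'j set" and wJ :: "'j \<Rightarrow> real"
    and K :: "'k set" and wK :: "'k \<Rightarrow> real"
    and Q :: "('j \<Rightarrow> complex) \<Rightarrow> ('k \<Rightarrow> complex) \<Rightarrow> 'i \<Rightarrow> complex"
    and f :: "'a \<Rightarrow> 'i \<Rightarrow> complex" and g :: "'b \<Rightarrow> 'j \<Rightarrow> complex" and h :: "'c \<Rightarrow> 'k \<Rightarrow> complex"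
    and \<epsilon> :: real
  assumes wI: "i \<in> I \<Longrightarrow> 0 \<le> wI i" and wJ: "j \<in> J \<Longrightarrow> 0 \<le> wJ j" and wK: "k \<in> K \<Longrightarrow> 0 \<le> wK k"
    and lin1: "Q (\<lambda>j. v j + c * v' j) w i = Q v w i + c * Q v' w i"
    and lin2: "Q v (\<lambda>k. w k + c * w' k) i = Q v w i + c * Q v w' i"
    and contr: "wsq I wI (Q v w) \<le> wsq J wJ v * wsq K wK w"
    and norm_f: "(\<Sum>x\<in>UNIV. margx \<mu> x * wsq I wI (f x)) = 1"
    and norm_g: "(\<Sum>y\<in>UNIV. margy \<mu> y * wsq J wJ (g y)) = 1"
    and norm_h: "(\<Sum>z\<in>UNIV. margz \<mu> z * wsq K wK (h z)) = 1"
    and eps_nonneg: "0 \<le> \<epsilon>" and eps_le: "\<epsilon> \<le> 1"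
    and near: "1 - \<epsilon> \<le> Re (\<Sum>(x, y, z)\<in>UNIV. of_real (\<mu> (x, y, z)) * T x y z * wip I wI (Q (g y) (h z)) (f x))"
begin

abbreviation "\<eta> \<equiv> 2 * A * \<epsilon>"

lemmas nonneg = wsq_nonneg[OF wI] wsq_nonneg[OF wJ] wsq_nonneg[OF wK]

lemmas cauchy_schwarz = wip_cauchy_schwarz[of I wI, OF wI]

lemma eta_nonneg: "0 \<le> \<eta>"
  using A_ge_1 eps_nonneg by simp

text \<open>The loss in the arithmetic-geometric inequality is the mean of three nonnegative terms:
  the mismatch of \<open>Q (g y) (h z)\<close> with \<open>cnj (T x y z)\<close> times
  \<open>f x\<close>, the loss from \<open>T\<close> having modulus below 1, and the loss of norm
  under \<open>Q\<close>. The mean is at most \<open>2 * \<epsilon>\<close>, hence each term is at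
  most \<eta> at every atom.\<close>

lemma deficits:
  assumes supp: "\<mu> (x, y, z) > 0"
  shows deficit_match: "wsq I wI (\<lambda>i. Q (g y) (h z) i - cnj (T x y z) * f x i) \<le> \<eta>"
    and deficit_T: "(1 - (cmod (T x y z))\<^sup>2) * wsq I wI (f x) \<le> \<eta>"
    and deficit_tensor: "wsq J wJ (g y) * wsq K wK (h z) - wsq I wI (Q (g y) (h z)) \<le> \<eta>"
proof -
  define \<theta>1 where "\<theta>1 x y z = wsq I wI (\<lambda>i. Q (g y) (h z) i - cnj (T x y z) * f x i)" for x y z
  define \<theta>2 where "\<theta>2 x y z = (1 - (cmod (T x y z))\<^sup>2) * wsq I wI (f x)" for x y z
  define \<theta>3 where "\<theta>3 y z = wsq J wJ (g y) * wsq K wK (h z) - wsq I wI (Q (g y) (h z))" for y z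
  have n1: "0 \<le> \<theta>1 x y z" for x y z unfolding \<theta>1_def by (rule nonneg)
  have n2: "0 \<le> \<theta>2 x y z" if "\<mu> (x, y, z) > 0" for x y z
    unfolding \<theta>2_def using T_le[OF that] by (auto intro!: mult_nonneg_nonneg nonneg simp: power_le_one)
  have n3: "0 \<le> \<theta>3 y z" for y z unfolding \<theta>3_def using contr by simp
  have tot: "\<theta>1 x y z + \<theta>2 x y z + \<theta>3 y z
     = wsq I wI (f x) + wsq J wJ (g y) * wsq K wK (h z) - 2 * Re (T x y z * wip I wI (Q (g y) (h z)) (f x))" for x y z
    unfolding \<theta>1_def \<theta>2_def \<theta>3_def wsq_diff wip_scale_right wsq_scale by (simp add: algebra_simps)
  have "(\<Sum>(x, y, z)\<in>UNIV. \<mu> (x, y, z) * (\<theta>1 x y z + \<theta>2 x y z + \<theta>3 y z))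
     = (\<Sum>(x, y, z)\<in>UNIV. \<mu> (x, y, z) * wsq I wI (f x))
       + (\<Sum>(x, y, z)\<in>UNIV. \<mu> (x, y, z) * (wsq J wJ (g y) * wsq K wK (h z)))
       - 2 * Re (\<Sum>(x, y, z)\<in>UNIV. of_real (\<mu> (x, y, z)) * T x y z * wip I wI (Q (g y) (h z)) (f x))"
    unfolding tot Re_sum sum_distrib_left sum.distrib[symmetric] sum_subtractf[symmetric]
    by (intro sum.cong refl) (auto simp: algebra_simps)
  also have "\<dots> \<le> 2 * \<epsilon>"
    using near unfolding expect_x expect_yz norm_f norm_g norm_h by simp
  finally have "\<theta>1 x y z + \<theta>2 x y z + \<theta>3 y z \<le> A * (2 * \<epsilon>)"
    by (intro point_le_expect[OF _ _ supp, where \<theta>="\<lambda>x y z. \<theta>1 x y z + \<theta>2 x y z + \<theta>3 y z"]) (simp_all add: n1 n2 n3)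
  then have "\<theta>1 x y z \<le> \<eta>" "\<theta>2 x y z \<le> \<eta>" "\<theta>3 y z \<le> \<eta>"
    using n1[of x y z] n2[OF supp] n3[of y z] by (simp_all add: mult_ac)
  then show "wsq I wI (\<lambda>i. Q (g y) (h z) i - cnj (T x y z) * f x i) \<le> \<eta>"
    "(1 - (cmod (T x y z))\<^sup>2) * wsq I wI (f x) \<le> \<eta>"
    "wsq J wJ (g y) * wsq K wK (h z) - wsq I wI (Q (g y) (h z)) \<le> \<eta>"
    unfolding \<theta>1_def \<theta>2_def \<theta>3_def .
qed

lemma weighted_point_le:
  fixes w \<phi> :: "'u::finite \<Rightarrow> real"
  assumes "\<And>u. 0 \<le> w u" "\<And>u. 0 \<le> \<phi> u" "(\<Sum>u\<in>UNIV. w u * \<phi> u) = 1" "1 \<le> A * w u"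
  shows "\<phi> u \<le> A"
proof -
  have "w u * \<phi> u \<le> 1"
    using member_le_sum[of u UNIV "\<lambda>u. w u * \<phi> u"] assms by auto
  then have "A * (w u * \<phi> u) \<le> A * 1" using A_ge_1 by (intro mult_left_mono) auto
  moreover have "1 * \<phi> u \<le> (A * w u) * \<phi> u" using assms by (intro mult_right_mono) auto
  ultimately show ?thesis by (simp add: mult.assoc)
qed

lemma pointwise_norms:
  assumes "\<mu> (x, y, z) > 0"
  shows "wsq I wI (f x) \<le> A" "wsq J wJ (g y) \<le> A" "wsq K wK (h z) \<le> A"
  using marg_min[OF assms] norm_f norm_g norm_h
  by (auto intro!: weighted_point_le[of p "\<lambda>x. wsq I wI (f x)"] weighted_point_le[of q "\<lambda>y. wsq J wJ (g y)"]
        weighted_point_le[of r "\<lambda>z. wsq K wK (h z)"] nonneg marg_nonneg)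

text \<open>By independence, any \<open>y\<close> and \<open>z\<close> that occur also occur
  together. The polarized bound in \<open>probe_ieff\<close> needs deficits at the mixed pairs
  \<open>(y0, z)\<close> and \<open>(y, z0)\<close>.\<close>

lemma yz_supp: "\<mu> (x, y, z) > 0 \<Longrightarrow> \<mu> (x', y', z') > 0 \<Longrightarrow> \<exists>x''. \<mu> (x'', y, z') > 0"
proof -
  assume a: "\<mu> (x, y, z) > 0" "\<mu> (x', y', z') > 0"
  have "margyz \<mu> y z' > 0"
    unfolding yz_indep using mu_le_marg(2)[of x y z] mu_le_marg(3)[of x' y' z'] a by (intro mult_pos_pos) linarith+
  then show ?thesis
    unfolding margyz_def by (intro ccontr[of "\<exists>x''. _ x''"]) (simp add: not_less order_antisym[OF _ mu_nonneg])
qed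

lemma Q_norm:
  assumes "\<mu> (x, y, z) > 0"
  shows "wsq I wI (Q (g y) (h z)) \<le> A\<^sup>2"
proof -
  have "wsq I wI (Q (g y) (h z)) \<le> wsq J wJ (g y) * wsq K wK (h z)" by (rule contr)
  also have "\<dots> \<le> A * A" using pointwise_norms[OF assms] A_ge_1 nonneg by (intro mult_mono) auto
  finally show ?thesis by (simp add: power2_eq_square)
qed

text \<open>With \<open>P = Q (g y0) (h z0)\<close>, the number \<open>T x y z * F x\<close> is the
  pairing of \<open>P\<close> with \<open>cnj (T x y z)\<close> times \<open>f x\<close>, hence
  nearly the pairing of \<open>P\<close> with \<open>Q (g y) (h z)\<close>. By
  \<open>bilinear_contraction_almost_tensor\<close> that nearly factors as \<open>G y * H z\<close>,
  so \<open>F\<close>, \<open>G\<close>, \<open>H\<close> have a small scalar defect.\<close>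

lemma probe_ieff:
  assumes supp0: "\<mu> (x0, y0, z0) > 0"
  shows "ieff p S (\<lambda>x. wip I wI (Q (g y0) (h z0)) (f x)) ^ N \<le> const\<^sub>1 * \<epsilon>"
proof -
  define P where "P = Q (g y0) (h z0)"
  define F where "F x = wip I wI P (f x)" for x
  define G where "G y = wip J wJ (g y0) (g y)" for y
  define H where "H z = wip K wK (h z0) (h z)" for z
  have P: "wsq I wI P \<le> A\<^sup>2" unfolding P_def by (rule Q_norm[OF supp0])
  have F2: "(cmod (F x))\<^sup>2 \<le> A\<^sup>2 * wsq I wI (f x)" for x
    using cauchy_schwarz[of P "f x"] mult_right_mono[OF P wsq_nonneg[of I wI "f x", OF wI]]
    unfolding F_def by linarith
  have pt: "\<mu> (x, y, z) * ((cmod (T x y z * F x - G y * H z))\<^sup>2 + (1 - (cmod (T x y z))\<^sup>2) * (cmod (F x))\<^sup>2)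
     \<le> \<mu> (x, y, z) * (134 * A ^ 3 * \<epsilon>)" for x y z
  proof (cases "\<mu> (x, y, z) = 0")
    case False
    then have s: "\<mu> (x, y, z) > 0" using mu_nonneg[of "(x, y, z)"] by linarith
    define e where "e i = Q (g y) (h z) i - cnj (T x y z) * f x i" for i
    have e: "wsq I wI e \<le> \<eta>" unfolding e_def by (rule deficit_match[OF s])
    have "T x y z * F x = wip I wI P (Q (g y) (h z)) - wip I wI P e"
      unfolding F_def e_def wip_diff_right wip_scale_right by simp
    then have "T x y z * F x - G y * H z = (wip I wI P (Q (g y) (h z)) - G y * H z) - wip I wI P e" by simp
    then have 1: "(cmod (T x y z * F x - G y * H z))\<^sup>2
        \<le> 2 * (cmod (wip I wI P (Q (g y) (h z)) - G y * H z))\<^sup>2 + 2 * (cmod (wip I wI P e))\<^sup>2"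
      by (simp only: cmod_diff_sq_le)
    have 2: "(cmod (wip I wI P e))\<^sup>2 \<le> A\<^sup>2 * \<eta>"
      using cauchy_schwarz[of P e] mult_mono[OF P e zero_le_power2 wsq_nonneg[OF wI]] by linarith
    obtain x1 x2 where s1: "\<mu> (x1, y0, z) > 0" and s2: "\<mu> (x2, y, z0) > 0"
      using yz_supp s supp0 by blast
    have "cmod (wip I wI P (Q (g y) (h z)) - G y * H z) \<le> 4 * \<eta>"
      using bilinear_contraction_almost_tensor[where Q=Q and I=I and wI=wI and J=J and wJ=wJ and K=K and wK=wK
          and ?v1.0="g y0" and ?w1.0="h z0" and ?v2.0="g y" and ?w2.0="h z", OF lin1 lin2 contr]
        deficit_tensor[OF s] deficit_tensor[OF supp0] deficit_tensor[OF s1] deficit_tensor[OF s2]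
      unfolding P_def G_def H_def by linarith
    then have "(cmod (wip I wI P (Q (g y) (h z)) - G y * H z))\<^sup>2 \<le> (4 * \<eta>)\<^sup>2"
      by (intro power_mono) auto
    then have 3: "(cmod (wip I wI P (Q (g y) (h z)) - G y * H z))\<^sup>2 \<le> 64 * A\<^sup>2 * \<epsilon>\<^sup>2"
      by (simp add: power_mult_distrib)
    have "(1 - (cmod (T x y z))\<^sup>2) * (cmod (F x))\<^sup>2 \<le> (1 - (cmod (T x y z))\<^sup>2) * (A\<^sup>2 * wsq I wI (f x))"
      using T_le[OF s] F2 by (intro mult_left_mono) (auto simp: power_le_one)
    also have "\<dots> = A\<^sup>2 * ((1 - (cmod (T x y z))\<^sup>2) * wsq I wI (f x))" by (simp add: mult_ac)
    also have "\<dots> \<le> A\<^sup>2 * \<eta>" by (intro mult_left_mono deficit_T[OF s]) simp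
    finally have 4: "(1 - (cmod (T x y z))\<^sup>2) * (cmod (F x))\<^sup>2 \<le> A\<^sup>2 * \<eta>" .
    have "\<epsilon>\<^sup>2 \<le> \<epsilon>" using eps_nonneg eps_le by (simp add: power2_eq_square mult_left_le)
    then have "A\<^sup>2 * \<epsilon>\<^sup>2 \<le> A ^ 3 * \<epsilon>"
      using A_ge_1 by (intro mult_mono power_increasing) auto
    \<comment> \<open>Twice \<open>64 * A\<^sup>2 * \<epsilon>\<^sup>2\<close> gives 128, and three
      copies of \<open>A\<^sup>2 * \<eta>\<close> give 6.\<close>
    with 1 2 3 4 have "(cmod (T x y z * F x - G y * H z))\<^sup>2 + (1 - (cmod (T x y z))\<^sup>2) * (cmod (F x))\<^sup>2
      \<le> 134 * A ^ 3 * \<epsilon>"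
      by (simp add: power2_eq_square power3_eq_cube)
    then show ?thesis using s by (intro mult_left_mono) auto
  qed simp
  have "(\<Sum>(x, y, z)\<in>UNIV. \<mu> (x, y, z) *
      ((cmod (T x y z * F x - G y * H z))\<^sup>2 + (1 - (cmod (T x y z))\<^sup>2) * (cmod (F x))\<^sup>2))
     \<le> (\<Sum>(x, y, z)\<in>UNIV. \<mu> (x, y, z) * (134 * A ^ 3 * \<epsilon>))"
    using pt by (intro sum_mono) auto
  also have "\<dots> = 134 * A ^ 3 * \<epsilon>"
    unfolding expect_x by (simp add: sum_p sum_distrib_right[symmetric])
  finally have \<kappa>: "(\<Sum>(x, y, z)\<in>UNIV. \<mu> (x, y, z) *
      ((cmod (T x y z * F x - G y * H z))\<^sup>2 + (1 - (cmod (T x y z))\<^sup>2) * (cmod (F x))\<^sup>2)) \<le> 134 * A ^ 3 * \<epsilon>" .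
  have "(nrm1 p F)\<^sup>2 \<le> (\<Sum>x\<in>UNIV. A\<^sup>2 * (p x * wsq I wI (f x)))"
    unfolding nrm1_sq[OF marg_nonneg(1)]
    using mult_left_mono[OF F2 marg_nonneg(1)] by (intro sum_mono) (simp add: mult_ac)
  then have "(nrm1 p F)\<^sup>2 \<le> A\<^sup>2" unfolding sum_distrib_left[symmetric] norm_f by simp
  from scalar_near_extremal[OF \<kappa> this] show ?thesis
    unfolding F_def P_def const\<^sub>1_def by (simp only: mult.assoc)
qed

text \<open>The bound of \<open>probe_ieff\<close> on the influence of a probe, with the power
  \<open>N\<close> removed.\<close>

definition \<rho> :: real where
  "\<rho> = root N (const\<^sub>1 * \<epsilon>)"

lemma rho: "0 \<le> \<rho>" "\<rho> ^ N = const\<^sub>1 * \<epsilon>"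
  unfolding \<rho>_def using const1_nonneg eps_nonneg N_pos by (auto simp: real_root_pow_pos2)

lemma norm_diff_le:
  assumes "p x1 > 0" "p x2 > 0"
  shows "wsq I wI (\<lambda>i. f x1 i - f x2 i) \<le> 4 * A"
proof -
  have "wsq I wI (f x) \<le> A" if "p x > 0" for x
    using p_pos_supp[OF that] pointwise_norms(1) by blast
  from this[OF assms(1)] this[OF assms(2)] show ?thesis
    using wsq_diff_le[of I wI "f x1" "f x2", OF wI] by linarith
qed

text \<open>A probe taken at an atom above \<open>x1\<close> is close to
  \<open>cnj t * f x1\<close>, and pairing with the probe takes nearly equal values at
  \<open>x1\<close> and \<open>x2\<close>. This bounds the pairing only up to the factor
  \<open>cmod t\<close>; the missing part \<open>1 - cmod t\<close> is bounded separately through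
  \<open>deficit_T\<close>.\<close>

lemma wip_f_diff_le:
  assumes S: "x1 \<in> S" "x2 \<in> S" and pos: "p x1 > 0" "p x2 > 0"
  shows "cmod (wip I wI (f x1) (\<lambda>i. f x1 i - f x2 i)) \<le> A * sqrt \<rho> + 4 * sqrt (A * \<eta>)"
proof -
  obtain y0 z0 where s: "\<mu> (x1, y0, z0) > 0" using p_pos_supp[OF pos(1)] by blast
  define P where "P = Q (g y0) (h z0)"
  define F where "F x = wip I wI P (f x)" for x
  define t where "t = T x1 y0 z0"
  define \<Delta> where "\<Delta> i = f x1 i - f x2 i" for i
  define e where "e i = P i - cnj t * f x1 i" for i
  have t: "cmod t \<le> 1" unfolding t_def by (rule T_le[OF s])
  have e: "wsq I wI e \<le> \<eta>" unfolding e_def P_def t_def by (rule deficit_match[OF s])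
  have \<Delta>: "wsq I wI \<Delta> \<le> 4 * A" unfolding \<Delta>_def by (rule norm_diff_le[OF pos])
  have err: "cmod (wip I wI u \<Delta>) \<le> 2 * sqrt (A * \<eta>)" if "wsq I wI u \<le> \<eta>" for u
  proof -
    have "(cmod (wip I wI u \<Delta>))\<^sup>2 \<le> \<eta> * (4 * A)"
      using cauchy_schwarz[of u \<Delta>] mult_mono[OF that \<Delta> eta_nonneg nonneg(1)] by linarith
    then have "cmod (wip I wI u \<Delta>) \<le> sqrt (4 * (A * \<eta>))" by (intro real_le_rsqrt) (simp add: mult_ac)
    then show ?thesis by (simp only: real_sqrt_mult real_sqrt_four)
  qed
  have "ieff p S F ^ N \<le> \<rho> ^ N"
    using probe_ieff[OF s] unfolding F_def[abs_def] P_def rho(2) .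
  then have "ieff p S F \<le> \<rho>"
    using power_mono_iff[OF ieff_nonneg rho(1) N_pos] by blast
  moreover have "p x1 * p x2 * (cmod (F x1 - F x2))\<^sup>2 \<le> ieff p S F"
  proof -
    let ?k = "\<lambda>x x'. if x \<in> S \<and> x' \<in> S then p x * p x' * (cmod (F x - F x'))\<^sup>2 else 0"
    have k: "0 \<le> ?k x x'" for x x' by (simp add: marg_nonneg)
    have "?k x1 x2 \<le> (\<Sum>x'\<in>UNIV. ?k x1 x')" using k by (intro member_le_sum) auto
    also have "\<dots> \<le> ieff p S F" unfolding ieff_def
      by (rule member_le_sum[of x1 UNIV "\<lambda>x. \<Sum>x'\<in>UNIV. ?k x x'"]) (auto intro!: sum_nonneg simp: marg_nonneg)
    finally show ?thesis using S by simp
  qed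
  ultimately have F\<rho>: "p x1 * p x2 * (cmod (F x1 - F x2))\<^sup>2 \<le> \<rho>" by linarith
  obtain y2 z2 where s2: "\<mu> (x2, y2, z2) > 0" using p_pos_supp[OF pos(2)] by blast
  \<comment> \<open>Both points have mass at least \<open>1 / A\<close>, so a single term of the
    influence is recovered at the cost \<open>A\<^sup>2\<close>.\<close>
  have "1 * 1 \<le> (A * p x1) * (A * p x2)"
    using marg_min(1)[OF s] marg_min(1)[OF s2] by (intro mult_mono) auto
  then have "1 * (cmod (F x1 - F x2))\<^sup>2 \<le> (A * p x1) * (A * p x2) * (cmod (F x1 - F x2))\<^sup>2"
    by (intro mult_right_mono) auto
  also have "\<dots> = A\<^sup>2 * (p x1 * p x2 * (cmod (F x1 - F x2))\<^sup>2)" by (simp add: power2_eq_square mult_ac)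
  also have "\<dots> \<le> A\<^sup>2 * \<rho>" using F\<rho> by (intro mult_left_mono) auto
  finally have "cmod (F x1 - F x2) \<le> sqrt (A\<^sup>2 * \<rho>)" by (intro real_le_rsqrt) simp
  then have F: "cmod (F x1 - F x2) \<le> A * sqrt \<rho>" using A_ge_1 by (simp add: real_sqrt_mult)
  have "wip I wI e \<Delta> = wip I wI P \<Delta> - cnj t * wip I wI (f x1) \<Delta>"
    unfolding e_def wip_diff_left by (simp add: wip_def sum_distrib_left mult_ac)
  moreover have "wip I wI P \<Delta> = F x1 - F x2" unfolding \<Delta>_def F_def wip_diff_right ..
  ultimately have "cnj t * wip I wI (f x1) \<Delta> = (F x1 - F x2) - wip I wI e \<Delta>" by simp
  then have "cmod (cnj t * wip I wI (f x1) \<Delta>) \<le> cmod (F x1 - F x2) + cmod (wip I wI e \<Delta>)"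
    by (metis norm_triangle_ineq4)
  then have 1: "cmod t * cmod (wip I wI (f x1) \<Delta>) \<le> A * sqrt \<rho> + 2 * sqrt (A * \<eta>)"
    using F err[OF e] by (simp add: norm_mult)
  \<comment> \<open>If \<open>cmod t\<close> is small, division by it would be useless; but then
    \<open>f x1\<close> itself is small, because \<open>(1 - cmod t)\<^sup>2\<close> is at most
    \<open>1 - (cmod t)\<^sup>2\<close>.\<close>
  have "wsq I wI (\<lambda>i. of_real (1 - cmod t) * f x1 i) \<le> (1 - (cmod t)\<^sup>2) * wsq I wI (f x1)"
  proof -
    have "(1 - cmod t)\<^sup>2 \<le> 1 - (cmod t)\<^sup>2"
      using t by (simp add: power2_eq_square algebra_simps mult_left_le)
    then show ?thesis
      unfolding wsq_scale norm_of_real power2_abs by (intro mult_right_mono nonneg)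
  qed
  then have "wsq I wI (\<lambda>i. of_real (1 - cmod t) * f x1 i) \<le> \<eta>"
    using deficit_T[OF s] unfolding t_def by linarith
  from err[OF this] have "cmod (of_real (1 - cmod t) * wip I wI (f x1) \<Delta>) \<le> 2 * sqrt (A * \<eta>)"
    by (simp add: wip_def sum_distrib_left mult_ac)
  then have "(1 - cmod t) * cmod (wip I wI (f x1) \<Delta>) \<le> 2 * sqrt (A * \<eta>)"
    using t by (simp only: norm_mult norm_of_real abs_of_nonneg diff_ge_0_iff_ge)
  with 1 have "cmod (wip I wI (f x1) \<Delta>) \<le> A * sqrt \<rho> + 4 * sqrt (A * \<eta>)"
    by (simp add: algebra_simps)
  then show ?thesis unfolding \<Delta>_def .
qed

text \<open>The squared norm of \<open>f x - f x'\<close> is its pairing with \<open>f x\<close>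
  minus its pairing with \<open>f x'\<close>, and \<open>wip_f_diff_le\<close> bounds both. Points
  of zero mass contribute nothing.\<close>

lemma veff_le: "veff p S I wI f \<le> 8 * sqrt (A * \<eta>) + 2 * (A * sqrt \<rho>)"
proof -
  let ?X = "8 * sqrt (A * \<eta>) + 2 * (A * sqrt \<rho>)"
  have X: "0 \<le> ?X" using A_ge_1 eta_nonneg rho by simp
  have "wsq I wI (\<lambda>i. f x i - f x' i) \<le> ?X" if "x \<in> S" "x' \<in> S" "p x > 0" "p x' > 0" for x x'
  proof -
    let ?D = "\<lambda>i. f x i - f x' i" and ?D' = "\<lambda>i. f x' i - f x i"
    have "of_real (wsq I wI ?D) = wip I wI (f x) ?D - wip I wI (f x') ?D"
      unfolding wip_self[symmetric] wip_diff_left ..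
    also have "\<dots> = wip I wI (f x) ?D + wip I wI (f x') ?D'"
      unfolding wip_diff_right by simp
    finally have "wsq I wI ?D \<le> cmod (wip I wI (f x) ?D) + cmod (wip I wI (f x') ?D')"
      by (metis abs_le_D1 norm_of_real norm_triangle_ineq)
    then show ?thesis using wip_f_diff_le[of x x'] wip_f_diff_le[of x' x] that by simp
  qed
  then have "(if x \<in> S \<and> x' \<in> S then p x * p x' * wsq I wI (\<lambda>i. f x i - f x' i) else 0) \<le> p x * p x' * ?X" for x x'
    using X marg_nonneg(1)[of x] marg_nonneg(1)[of x']
    by (cases "p x = 0"; cases "p x' = 0") (auto intro!: mult_left_mono mult_nonneg_nonneg)
  then have "veff p S I wI f \<le> (\<Sum>x\<in>UNIV. \<Sum>x'\<in>UNIV. p x * p x' * ?X)"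
    unfolding veff_def by (intro sum_mono)
  also have "\<dots> = ?X"
    unfolding sum_distrib_right[symmetric] sum_distrib_left[symmetric] sum_p by simp
  finally show ?thesis .
qed

lemma veff_nonneg: "0 \<le> veff p S I wI f"
  unfolding veff_def by (intro sum_nonneg) (auto simp: marg_nonneg nonneg)

text \<open>The exponent \<open>2 * N\<close> undoes both the root in \<rho> and the square root in
  \<open>veff_le\<close>, leaving a bound linear in \<epsilon>.\<close>

lemma veff_power_le: "veff p S I wI f ^ (2 * N) \<le> const\<^sub>2 * \<epsilon>"
proof -
  have "veff p S I wI f ^ (2 * N) \<le> (8 * sqrt (A * \<eta>) + 2 * (A * sqrt \<rho>)) ^ (2 * N)"
    by (intro power_mono veff_le veff_nonneg)
  also have "\<dots> \<le> 2 ^ (2 * N) * ((8 * sqrt (A * \<eta>)) ^ (2 * N) + (2 * (A * sqrt \<rho>)) ^ (2 * N))"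
    using A_ge_1 eta_nonneg rho by (intro sum_power_le) auto
  also have "\<dots> = 4 ^ N * ((128 * A\<^sup>2) ^ N * \<epsilon> ^ N + (4 * A\<^sup>2) ^ N * \<rho> ^ N)"
  proof -
    have "(8 * sqrt (A * \<eta>))\<^sup>2 = 128 * A\<^sup>2 * \<epsilon>"
      using A_ge_1 eta_nonneg by (simp add: power_mult_distrib) (simp add: power2_eq_square)
    moreover have "(2 * (A * sqrt \<rho>))\<^sup>2 = 4 * A\<^sup>2 * \<rho>"
      using A_ge_1 rho by (simp add: power_mult_distrib)
    ultimately show ?thesis by (simp only: power_mult) (simp add: power_mult_distrib)
  qed
  also have "\<dots> \<le> 4 ^ N * ((128 * A\<^sup>2) ^ N * \<epsilon> + (4 * A\<^sup>2) ^ N * (const\<^sub>1 * \<epsilon>))"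
    using N_pos eps_nonneg eps_le power_decreasing[of 1 N \<epsilon>] unfolding rho(2)
    by (intro mult_left_mono add_mono order_refl) auto
  finally show ?thesis unfolding const\<^sub>2_def by (simp add: algebra_simps)
qed

end

section \<open>From stability to a correlation bound with an explicit gap\<close>

context relaxed_base
begin

text \<open>Large enough that the factor gained per coordinate stays positive: the influence ratio
  is at most 2, and its power \<open>2 * N\<close> at most \<open>4 ^ N\<close>.\<close>

lemma const2_ge: "2 * 4 ^ N \<le> const\<^sub>2"
proof -
  have "128 * 1 \<le> 128 * A\<^sup>2" using A_ge_1 by (intro mult_left_mono) (auto simp: one_le_power)
  then have "(128 * A\<^sup>2) ^ 1 \<le> (128 * A\<^sup>2) ^ N" using N_pos by (intro power_increasing) auto
  with \<open>128 * 1 \<le> 128 * A\<^sup>2\<close> have "2 \<le> (128 * A\<^sup>2) ^ N" by simp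
  moreover have "0 \<le> (4 * A\<^sup>2) ^ N * const\<^sub>1" using const1_nonneg by simp
  ultimately have "2 \<le> (128 * A\<^sup>2) ^ N + (4 * A\<^sup>2) ^ N * const\<^sub>1" by linarith
  then have "4 ^ N * 2 \<le> 4 ^ N * ((128 * A\<^sup>2) ^ N + (4 * A\<^sup>2) ^ N * const\<^sub>1)"
    by (intro mult_left_mono) auto
  then show ?thesis unfolding const\<^sub>2_def by simp
qed

lemma const2_pos: "0 < const\<^sub>2"
  using const2_ge by (rule less_le_trans[rotated]) simp

context
  fixes I :: "'i set" and wI :: "'i \<Rightarrow> real" and J :: "'j set" and wJ :: "'j \<Rightarrow> real"
    and K :: "'k set" and wK :: "'k \<Rightarrow> real"
    and Q :: "('j \<Rightarrow> complex) \<Rightarrow> ('k \<Rightarrow> complex) \<Rightarrow> 'i \<Rightarrow> complex"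
  assumes wI: "\<And>i. i \<in> I \<Longrightarrow> 0 \<le> wI i" and wJ: "\<And>j. j \<in> J \<Longrightarrow> 0 \<le> wJ j"
    and wK: "\<And>k. k \<in> K \<Longrightarrow> 0 \<le> wK k"
    and lin1: "\<And>v v' c w i. Q (\<lambda>j. v j + c * v' j) w i = Q v w i + c * Q v' w i"
    and lin2: "\<And>v w w' c i. Q v (\<lambda>k. w k + c * w' k) i = Q v w i + c * Q v w' i"
    and contr: "\<And>v w. wsq I wI (Q v w) \<le> wsq J wJ v * wsq K wK w"
begin

text \<open>Take \<epsilon> to be the actual gap \<open>1 - E\<close>; then
  \<open>veff_power_le\<close> rearranges to the claim. The pointwise arithmetic-geometric
  inequality gives \<open>E \<le> 1\<close>, and \<open>0 \<le> E\<close> gives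
  \<open>\<epsilon> \<le> 1\<close>.\<close>

lemma vector_base_case_unit:
  assumes norm_f: "(\<Sum>x\<in>UNIV. p x * wsq I wI (f x)) = 1"
    and norm_g: "(\<Sum>y\<in>UNIV. q y * wsq J wJ (g y)) = 1"
    and norm_h: "(\<Sum>z\<in>UNIV. r z * wsq K wK (h z)) = 1"
  defines "E \<equiv> Re (\<Sum>(x, y, z)\<in>UNIV. of_real (\<mu> (x, y, z)) * T x y z * wip I wI (Q (g y) (h z)) (f x))"
  assumes E: "0 \<le> E"
  shows "E \<le> 1 - veff p S I wI f ^ (2 * N) / const\<^sub>2"
proof -
  have pt: "2 * (\<mu> (x, y, z) * Re (T x y z * wip I wI (Q (g y) (h z)) (f x)))
     \<le> \<mu> (x, y, z) * wsq I wI (f x) + \<mu> (x, y, z) * (wsq J wJ (g y) * wsq K wK (h z))" for x y z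
  proof (cases "\<mu> (x, y, z) = 0")
    case False
    then have s: "\<mu> (x, y, z) > 0" using mu_nonneg[of "(x, y, z)"] by linarith
    have "0 \<le> wsq I wI (\<lambda>i. Q (g y) (h z) i - cnj (T x y z) * f x i)" by (rule wsq_nonneg[OF wI])
    then have "2 * Re (T x y z * wip I wI (Q (g y) (h z)) (f x))
       \<le> wsq I wI (Q (g y) (h z)) + (cmod (T x y z))\<^sup>2 * wsq I wI (f x)"
      unfolding wsq_diff wip_scale_right wsq_scale by simp
    also have "\<dots> \<le> wsq J wJ (g y) * wsq K wK (h z) + 1 * wsq I wI (f x)"
      using T_le[OF s] by (intro add_mono contr mult_right_mono wsq_nonneg[OF wI]) (auto simp: power_le_one)
    finally have "\<mu> (x, y, z) * (2 * Re (T x y z * wip I wI (Q (g y) (h z)) (f x)))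
       \<le> \<mu> (x, y, z) * (wsq J wJ (g y) * wsq K wK (h z) + 1 * wsq I wI (f x))"
      using s by (intro mult_left_mono) auto
    then show ?thesis by (simp add: algebra_simps)
  qed simp
  have "2 * E = (\<Sum>(x, y, z)\<in>UNIV. 2 * (\<mu> (x, y, z) * Re (T x y z * wip I wI (Q (g y) (h z)) (f x))))"
    unfolding E_def Re_sum sum_distrib_left by (intro sum.cong refl) (auto simp: mult.assoc)
  also have "\<dots> \<le> (\<Sum>(x, y, z)\<in>UNIV. \<mu> (x, y, z) * wsq I wI (f x)) + (\<Sum>(x, y, z)\<in>UNIV. \<mu> (x, y, z) * (wsq J wJ (g y) * wsq K wK (h z)))"
    unfolding sum.distrib[symmetric] using pt by (intro sum_mono) auto
  also have "\<dots> = 2" unfolding expect_x expect_yz norm_f norm_g norm_h by simp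
  finally have "E \<le> 1" by simp
  interpret near_extremal \<mu> S T N c0 A I wI J wJ K wK Q f g h "1 - E"
    using wI wJ wK lin1 lin2 contr norm_f norm_g norm_h E \<open>E \<le> 1\<close>
    by unfold_locales (simp_all add: E_def)
  show ?thesis using veff_power_le const2_pos by (simp add: field_simps)
qed

lemma Q_scale: "Q (\<lambda>j. c * v j) w i = c * Q v w i" "Q v (\<lambda>k. c * w k) i = c * Q v w i"
proof -
  have "Q (\<lambda>_. 0) w i = 0" using lin1[of "\<lambda>_. 0" 1 "\<lambda>_. 0" w i] by simp
  then show "Q (\<lambda>j. c * v j) w i = c * Q v w i" using lin1[of "\<lambda>_. 0" c v w i] by simp
  have "Q v (\<lambda>_. 0) i = 0" using lin2[of v "\<lambda>_. 0" 1 "\<lambda>_. 0" i] by simp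
  then show "Q v (\<lambda>k. c * w k) i = c * Q v w i" using lin2[of v "\<lambda>_. 0" c w i] by simp
qed

text \<open>Reduction to unit norms by homogeneity, with a phase moved into \<open>f\<close> to make
  the correlation real and nonnegative.\<close>

lemma vector_base_case:
  fixes f :: "'a \<Rightarrow> 'i \<Rightarrow> complex" and g :: "'b \<Rightarrow> 'j \<Rightarrow> complex" and h :: "'c \<Rightarrow> 'k \<Rightarrow> complex"
  defines "F2 \<equiv> (\<Sum>x\<in>UNIV. p x * wsq I wI (f x))"
    and "G2 \<equiv> (\<Sum>y\<in>UNIV. q y * wsq J wJ (g y))"
    and "H2 \<equiv> (\<Sum>z\<in>UNIV. r z * wsq K wK (h z))"
  assumes \<tau>: "0 \<le> \<tau>" and V: "\<tau> * F2 \<le> veff p S I wI f"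
  shows "cmod (\<Sum>(x, y, z)\<in>UNIV. of_real (\<mu> (x, y, z)) * T x y z * wip I wI (Q (g y) (h z)) (f x))
    \<le> (1 - \<tau> ^ (2 * N) / const\<^sub>2) * sqrt F2 * sqrt G2 * sqrt H2"
proof -
  define E where "E = (\<Sum>(x, y, z)\<in>UNIV. of_real (\<mu> (x, y, z)) * T x y z * wip I wI (Q (g y) (h z)) (f x))"
  have nn: "0 \<le> F2" "0 \<le> G2" "0 \<le> H2"
    unfolding F2_def G2_def H2_def
    by (auto intro!: sum_nonneg mult_nonneg_nonneg marg_nonneg wsq_nonneg wI wJ wK)
  have zero_point: "k u = 0"
    if "(\<Sum>u\<in>UNIV. m u * k u) = 0" "\<And>u. 0 \<le> m u" "\<And>u. 0 \<le> k u" "0 < m u"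
    for m k :: "'u::finite \<Rightarrow> real" and u
    using that sum_nonneg_eq_0_iff[of UNIV "\<lambda>u. m u * k u"] by simp (metis less_irrefl)
  show ?thesis
  proof (cases "F2 = 0 \<or> G2 = 0 \<or> H2 = 0")
    case True
    \<comment> \<open>A vanishing norm kills that function at every point of positive mass, and
      \<open>contr\<close> with Cauchy-Schwarz then kills every summand.\<close>
    have "of_real (\<mu> (x, y, z)) * T x y z * wip I wI (Q (g y) (h z)) (f x) = 0" for x y z
    proof (cases "\<mu> (x, y, z) = 0")
      case False
      then have s: "\<mu> (x, y, z) > 0" using mu_nonneg[of "(x, y, z)"] by linarith
      have pos: "p x > 0" "q y > 0" "r z > 0" using s mu_le_marg[where x=x and y=y and z=z] by linarith+
      have "wsq I wI (f x) = 0 \<or> wsq J wJ (g y) = 0 \<or> wsq K wK (h z) = 0"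
        using True zero_point[of p "\<lambda>x. wsq I wI (f x)" x] zero_point[of q "\<lambda>y. wsq J wJ (g y)" y]
          zero_point[of r "\<lambda>z. wsq K wK (h z)" z] pos
        unfolding F2_def G2_def H2_def
        by (auto simp: marg_nonneg wsq_nonneg[OF wI] wsq_nonneg[OF wJ] wsq_nonneg[OF wK])
      then have "wsq I wI (f x) = 0 \<or> wsq I wI (Q (g y) (h z)) = 0"
        using contr[of "g y" "h z"] wsq_nonneg[of I wI "Q (g y) (h z)", OF wI] by auto
      then have "(cmod (wip I wI (Q (g y) (h z)) (f x)))\<^sup>2 \<le> 0"
        using wip_cauchy_schwarz[of I wI "Q (g y) (h z)" "f x", OF wI] by auto
      then show ?thesis by simp
    qed simp
    then have "E = 0" unfolding E_def by (intro sum.neutral) auto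
    then show ?thesis using True unfolding E_def by auto
  next
    case False
    with nn have pos: "F2 > 0" "G2 > 0" "H2 > 0" by auto
    \<comment> \<open>Since \<open>f\<close> sits in the conjugated slot of \<open>wip\<close>,
      multiplying it by the phase of \<open>E\<close> turns \<open>E\<close> into its modulus; the
      value 1 keeps \<omega> unimodular when \<open>E = 0\<close>.\<close>
    define \<omega> where "\<omega> = (if E = 0 then 1 else sgn E)"
    have \<omega>: "cmod \<omega> = 1" "cnj \<omega> * E = of_real (cmod E)"
    proof -
      show "cmod \<omega> = 1" by (simp add: \<omega>_def norm_sgn)
      have "cnj (sgn E) * E = of_real (cmod E)" if "E \<noteq> 0"
        using that complex_norm_square[of E] by (simp add: sgn_div_norm scaleR_conv_of_real field_simps power2_eq_square)
      then show "cnj \<omega> * E = of_real (cmod E)" by (simp add: \<omega>_def)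
    qed
    define a where "a = 1 / sqrt F2" define b where "b = 1 / sqrt G2" define c where "c = 1 / sqrt H2"
    have sq: "a\<^sup>2 = 1 / F2" "b\<^sup>2 = 1 / G2" "c\<^sup>2 = 1 / H2" using pos by (auto simp: a_def b_def c_def power_divide)
    have abc: "0 < a" "0 < b" "0 < c" using pos by (auto simp: a_def b_def c_def)
    define f' where "f' x = (\<lambda>i. (of_real a * \<omega>) * f x i)" for x
    define g' where "g' y = (\<lambda>j. of_real b * g y j)" for y
    define h' where "h' z = (\<lambda>k. of_real c * h z k)" for z
    have n1: "(\<Sum>x\<in>UNIV. p x * wsq I wI (f' x)) = 1"
    proof -
      have "(\<Sum>x\<in>UNIV. p x * wsq I wI (f' x)) = a\<^sup>2 * F2"
        unfolding f'_def wsq_scale F2_def sum_distrib_left by (simp add: norm_mult \<omega> mult_ac)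
      then show ?thesis using sq pos by simp
    qed
    have n2: "(\<Sum>y\<in>UNIV. q y * wsq J wJ (g' y)) = 1"
    proof -
      have "(\<Sum>y\<in>UNIV. q y * wsq J wJ (g' y)) = b\<^sup>2 * G2"
        unfolding g'_def wsq_scale G2_def sum_distrib_left by (simp add: mult_ac)
      then show ?thesis using sq pos by simp
    qed
    have n3: "(\<Sum>z\<in>UNIV. r z * wsq K wK (h' z)) = 1"
    proof -
      have "(\<Sum>z\<in>UNIV. r z * wsq K wK (h' z)) = c\<^sup>2 * H2"
        unfolding h'_def wsq_scale H2_def sum_distrib_left by (simp add: mult_ac)
      then show ?thesis using sq pos by simp
    qed
    have Q': "Q (g' y) (h' z) = (\<lambda>i. of_real (b * c) * Q (g y) (h z) i)" for y z
      unfolding g'_def h'_def by (rule ext) (simp add: Q_scale)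
    have "wip I wI (Q (g' y) (h' z)) (f' x) = of_real (a * b * c) * cnj \<omega> * wip I wI (Q (g y) (h z)) (f x)" for x y z
      unfolding Q' f'_def wip_scale_right by (simp add: wip_def sum_distrib_left mult_ac)
    then have "(\<Sum>(x, y, z)\<in>UNIV. of_real (\<mu> (x, y, z)) * T x y z * wip I wI (Q (g' y) (h' z)) (f' x))
       = of_real (a * b * c) * (cnj \<omega> * E)"
      unfolding E_def sum_distrib_left by (intro sum.cong refl) (auto simp: mult_ac)
    then have E': "Re (\<Sum>(x, y, z)\<in>UNIV. of_real (\<mu> (x, y, z)) * T x y z * wip I wI (Q (g' y) (h' z)) (f' x)) = a * b * c * cmod E"
      unfolding \<omega> by simp
    have "wsq I wI (\<lambda>i. f' x i - f' x' i) = a\<^sup>2 * wsq I wI (\<lambda>i. f x i - f x' i)" for x x'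
    proof -
      have "(\<lambda>i. f' x i - f' x' i) = (\<lambda>i. (of_real a * \<omega>) * (f x i - f x' i))"
        unfolding f'_def by (simp add: algebra_simps)
      then show ?thesis by (simp add: wsq_scale norm_mult \<omega>)
    qed
    then have "veff p S I wI f' = a\<^sup>2 * veff p S I wI f"
      unfolding veff_def sum_distrib_left by (intro sum.cong refl) (auto simp: mult_ac)
    then have "\<tau> \<le> veff p S I wI f'" using V pos sq by (simp add: pos_le_divide_eq)
    then have "\<tau> ^ (2 * N) / const\<^sub>2 \<le> veff p S I wI f' ^ (2 * N) / const\<^sub>2"
      using \<tau> const2_pos by (intro divide_right_mono power_mono) auto
    moreover have "a * b * c * cmod E \<le> 1 - veff p S I wI f' ^ (2 * N) / const\<^sub>2"
      using vector_base_case_unit[OF n1 n2 n3] abc unfolding E' by simp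
    ultimately have "a * b * c * cmod E \<le> 1 - \<tau> ^ (2 * N) / const\<^sub>2" by linarith
    then have "cmod E / (sqrt F2 * sqrt G2 * sqrt H2) \<le> 1 - \<tau> ^ (2 * N) / const\<^sub>2"
      unfolding a_def b_def c_def by simp
    then have "cmod E \<le> (1 - \<tau> ^ (2 * N) / const\<^sub>2) * (sqrt F2 * sqrt G2 * sqrt H2)"
      using pos by (subst (asm) pos_divide_le_eq) auto
    then show ?thesis unfolding E_def by (simp only: mult.assoc)
  qed
qed

end

end

subsection \<open>Inserting a coordinate\<close>

text \<open>The position is arbitrary because the influential coordinate to be peeled off may be
  anywhere.\<close>

definition ins :: "nat \<Rightarrow> 'x \<Rightarrow> 'x list \<Rightarrow> 'x list" where
  "ins i a l = take i l @ a # drop i l"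

abbreviation words :: "'x set \<Rightarrow> nat \<Rightarrow> 'x list set" where
  "words X n \<equiv> {l. length l = n \<and> set l \<subseteq> X}"

lemma length_ins [simp]: "length (ins i a l) = Suc (length l)"
  unfolding ins_def by simp

lemma set_ins [simp]: "set (ins i a l) = insert a (set l)"
proof -
  have "set l = set (take i l @ drop i l)" by simp
  then show ?thesis unfolding ins_def by (simp only: set_append) simp
qed

lemma map_ins: "map f (ins i a l) = ins i (f a) (map f l)"
  unfolding ins_def by (simp add: take_map drop_map)

lemma prod_list_ins: "prod_list (ins i a l) = a * prod_list l" for a :: "'x::comm_monoid_mult"
proof -
  have "prod_list l = prod_list (take i l) * prod_list (drop i l)"
    by (simp flip: prod_list.append)
  then show ?thesis unfolding ins_def by (simp add: mult.left_commute)
qed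

lemma nth_ins: "i \<le> length l \<Longrightarrow> ins i a l ! i = a"
  unfolding ins_def by (simp add: nth_append)

lemma zip_ins: "length l = length l' \<Longrightarrow> zip (ins i a l) (ins i b l') = ins i (a, b) (zip l l')"
  unfolding ins_def by (simp add: take_zip drop_zip)

lemma finite_words: "finite X \<Longrightarrow> finite (words X n)"
  using finite_lists_length_eq[of X n] by (simp add: conj_commute)

lemma bij_betw_ins:
  assumes "i \<le> n"
  shows "bij_betw (\<lambda>(a, l). ins i a l) (X \<times> words X n) (words X (Suc n))"
proof (rule bij_betw_byWitness[where f'="\<lambda>l. (l ! i, take i l @ drop (Suc i) l)"])
  show "\<forall>al\<in>X \<times> words X n. (\<lambda>l. (l ! i, take i l @ drop (Suc i) l)) ((\<lambda>(a, l). ins i a l) al) = al"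
    using assms by (auto simp: ins_def nth_append)
  show "\<forall>l\<in>words X (Suc n). (\<lambda>(a, l). ins i a l) ((\<lambda>l. (l ! i, take i l @ drop (Suc i) l)) l) = l"
    using assms by (auto simp: ins_def id_take_nth_drop[symmetric])
  show "(\<lambda>(a, l). ins i a l) ` (X \<times> words X n) \<subseteq> words X (Suc n)" by auto
  show "(\<lambda>l. (l ! i, take i l @ drop (Suc i) l)) ` words X (Suc n) \<subseteq> X \<times> words X n"
    using assms by (auto dest!: in_set_takeD in_set_dropD simp: subset_iff)
qed

lemma sum_words_ins:
  assumes "i \<le> n"
  shows "(\<Sum>l\<in>words X (Suc n). \<phi> l) = (\<Sum>a\<in>X. \<Sum>l\<in>words X n. \<phi> (ins i a l))"
  unfolding sum.cartesian_product using sum.reindex_bij_betw[OF bij_betw_ins[OF assms], of \<phi> X]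
  by (simp add: case_prod_unfold)

lemma sum_length_ins:
  assumes "i \<le> n"
  shows "(\<Sum>l\<in>{l. length l = Suc n}. \<phi> l) = (\<Sum>a\<in>UNIV. \<Sum>l\<in>{l. length l = n}. \<phi> (ins i a l))"
  using sum_words_ins[OF assms, of \<phi> UNIV] by simp

lemma tensor_ins: "length ch = length l \<Longrightarrow> tensor (ins i b ch) (ins i a l) = b a * tensor ch l"
  unfolding tensor_def by (simp add: zip_ins map_ins prod_list_ins)

lemma effdeg_filter: "effdeg B ch = length (filter (\<lambda>b. b \<in> B) ch)"
  unfolding effdeg_def by (simp add: length_filter_conv_card)

lemma effdeg_ins: "effdeg B (ins i b ch) = (if b \<in> B then 1 else 0) + effdeg B ch"
proof -
  have "effdeg B ch = effdeg B (take i ch @ drop i ch)" by simp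
  then show ?thesis unfolding effdeg_filter ins_def by (simp only: filter_append length_append) simp
qed

lemma effdeg_eq_sum: "length ch = n \<Longrightarrow> effdeg B ch = (\<Sum>i<n. if ch ! i \<in> B then 1 else 0)"
  unfolding effdeg_def by (simp add: sum.If_cases Int_def lessThan_def)

section \<open>Slicing norms and correlations, and Parseval for tensors\<close>

abbreviation L2sq :: "('u::finite \<Rightarrow> real) \<Rightarrow> nat \<Rightarrow> ('u list \<Rightarrow> complex) \<Rightarrow> real" where
  "L2sq m n \<equiv> wsq {l. length l = n} (\<lambda>l. prod_list (map m l))"

lemma nrm_eq_sqrt: "nrm m n F = sqrt (L2sq m n F)"
  unfolding nrm_def wsq_def ..

lemma L2sq_ins:
  assumes "i \<le> n"
  shows "L2sq m (Suc n) F = (\<Sum>a\<in>UNIV. m a * L2sq m n (\<lambda>l. F (ins i a l)))"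
  unfolding wsq_def sum_length_ins[OF assms]
  by (simp add: map_ins prod_list_ins sum_distrib_left mult.assoc)

lemma corr_ins:
  assumes "i \<le> n"
  shows "corr \<mu> (Suc n) F G H T = (\<Sum>(x, y, z)\<in>UNIV. of_real (\<mu> (x, y, z)) * T x y z *
    corr \<mu> n (\<lambda>l. F (ins i x l)) (\<lambda>l. G (ins i y l)) (\<lambda>l. H (ins i z l)) T)"
  unfolding corr_def sum_length_ins[OF assms] sum_distrib_left
  by (intro sum.cong refl) (auto simp: map_ins prod_list_ins mult_ac intro!: sum.cong)

lemma corr_lin_F: "corr \<mu> n (\<lambda>l. \<Sum>k\<in>X. u k * F k l) G H T = (\<Sum>k\<in>X. u k * corr \<mu> n (F k) G H T)"
  unfolding corr_def sum_distrib_left sum_distrib_right by (subst sum.swap) (simp add: mult_ac)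

lemma corr_scale_F: "corr \<mu> n (\<lambda>l. c * F l) G H T = c * corr \<mu> n F G H T"
  unfolding corr_def sum_distrib_left by (simp add: mult_ac)

lemma corr_lin_G: "corr \<mu> n F (\<lambda>l. G l + c * G' l) H T = corr \<mu> n F G H T + c * corr \<mu> n F G' H T"
  unfolding corr_def sum_distrib_left sum.distrib[symmetric] by (simp add: algebra_simps)

lemma corr_lin_H: "corr \<mu> n F G (\<lambda>l. H l + c * H' l) T = corr \<mu> n F G H T + c * corr \<mu> n F G H' T"
  unfolding corr_def sum_distrib_left sum.distrib[symmetric] by (simp add: algebra_simps)

lemma prod_list_nonneg: "(\<And>a. 0 \<le> m a) \<Longrightarrow> 0 \<le> prod_list (map m l)" for m :: "'u \<Rightarrow> real"
  by (induction l) auto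

lemma parseval:
  assumes fin: "finite B" and on: "orthonormal_fam p B" 
  shows "(\<Sum>x\<in>UNIV. p x * (cmod (\<Sum>b\<in>B. u b * b x))\<^sup>2) = (\<Sum>b\<in>B. (cmod (u b))\<^sup>2)"
proof -
  have "complex_of_real (\<Sum>x\<in>UNIV. p x * (cmod (\<Sum>b\<in>B. u b * b x))\<^sup>2)
     = (\<Sum>x\<in>UNIV. \<Sum>b\<in>B. \<Sum>b'\<in>B. u b * cnj (u b') * (of_real (p x) * b x * cnj (b' x)))"
    by (simp only: of_real_sum of_real_mult complex_norm_square cnj_sum sum_product)
       (simp add: sum_distrib_left mult_ac)
  also have "\<dots> = (\<Sum>b\<in>B. \<Sum>x\<in>UNIV. \<Sum>b'\<in>B. u b * cnj (u b') * (of_real (p x) * b x * cnj (b' x)))"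
    by (rule sum.swap)
  also have "\<dots> = (\<Sum>b\<in>B. \<Sum>b'\<in>B. \<Sum>x\<in>UNIV. u b * cnj (u b') * (of_real (p x) * b x * cnj (b' x)))"
    by (intro sum.cong refl sum.swap)
  also have "\<dots> = (\<Sum>b\<in>B. \<Sum>b'\<in>B. u b * cnj (u b') * ipx p b b')"
    unfolding ipx_def sum_distrib_left ..
  also have "\<dots> = (\<Sum>b\<in>B. \<Sum>b'\<in>B. if b' = b then u b * cnj (u b) else 0)"
    using on unfolding orthonormal_fam_def by (intro sum.cong refl) auto
  also have "\<dots> = of_real (\<Sum>b\<in>B. (cmod (u b))\<^sup>2)"
    using fin by (simp add: complex_norm_square[symmetric])
  finally show ?thesis by (simp only: of_real_eq_iff)
qed

text \<open>Slice off the first coordinate: the induction hypothesis handles the rest for each fixed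
  letter, and \<open>parseval\<close> then handles that letter.\<close>

lemma parseval_tensor:
  assumes fin: "finite B" and on: "orthonormal_fam p B"
  shows "L2sq p n (\<lambda>l. \<Sum>ch\<in>words B n. u ch * tensor ch l) = (\<Sum>ch\<in>words B n. (cmod (u ch))\<^sup>2)"
proof (induction n arbitrary: u)
  case 0
  have "words B 0 = {[]}" "{l::'a list. length l = 0} = {[]}" by auto
  then show ?case by (simp add: wsq_def tensor_def)
next
  case (Suc n)
  have slice: "(\<Sum>ch\<in>words B (Suc n). u ch * tensor ch (ins 0 a l))
      = (\<Sum>ch\<in>words B n. (\<Sum>b\<in>B. u (ins 0 b ch) * b a) * tensor ch l)" if "length l = n" for a l
    unfolding sum_words_ins[of 0 n, OF le0] sum_distrib_right using that
    by (subst sum.swap) (auto intro!: sum.cong simp: tensor_ins mult_ac)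
  have "L2sq p (Suc n) (\<lambda>l. \<Sum>ch\<in>words B (Suc n). u ch * tensor ch l)
      = (\<Sum>a\<in>UNIV. p a * L2sq p n (\<lambda>l. \<Sum>ch\<in>words B n. (\<Sum>b\<in>B. u (ins 0 b ch) * b a) * tensor ch l))"
    unfolding L2sq_ins[of 0 n, OF le0] by (intro sum.cong refl) (simp add: wsq_def slice)
  also have "\<dots> = (\<Sum>ch\<in>words B n. \<Sum>a\<in>UNIV. p a * (cmod (\<Sum>b\<in>B. u (ins 0 b ch) * b a))\<^sup>2)"
    unfolding Suc.IH sum_distrib_left by (rule sum.swap)
  also have "\<dots> = (\<Sum>ch\<in>words B n. \<Sum>b\<in>B. (cmod (u (ins 0 b ch)))\<^sup>2)"
    unfolding parseval[OF assms] ..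
  also have "\<dots> = (\<Sum>ch\<in>words B (Suc n). (cmod (u ch))\<^sup>2)"
    unfolding sum_words_ins[of 0 n, OF le0] by (rule sum.swap)
  finally show ?case .
qed

subsection \<open>Effective influence in the basis\<close>

context relaxed_base
begin

context
  fixes B1 B2 :: "('a \<Rightarrow> complex) set"
  assumes basis: "eff_basis p S B1 B2"
begin

lemma finite_B: "finite (B1 \<union> B2)" "finite B2"
  using basis unfolding eff_basis_def onb_of_def by auto

lemma orthonormal_B: "orthonormal_fam p (B1 \<union> B2)" "orthonormal_fam p B2"
  using basis unfolding eff_basis_def onb_of_def by auto

lemma B1_const: "b \<in> B1 \<Longrightarrow> x \<in> S \<Longrightarrow> x' \<in> S \<Longrightarrow> b x = b x'"
  using basis unfolding eff_basis_def onb_of_def const_on_def by blast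

lemma B2_supp: "b \<in> B2 \<Longrightarrow> x \<notin> S \<Longrightarrow> b x = 0"
  using basis unfolding eff_basis_def onb_of_def supp_on_perp_const_def by blast

lemma B2_mean: "b \<in> B2 \<Longrightarrow> (\<Sum>x\<in>UNIV. of_real (p x) * b x) = 0"
  using basis unfolding eff_basis_def onb_of_def supp_on_perp_const_def ipx_def by auto

end

text \<open>If \<open>S\<close> is null then \<open>B\<^sub>2\<close> is empty and the scale is irrelevant; it only has to be positive.\<close>

definition eff_scale :: real where
  "eff_scale = (if (\<Sum>x\<in>S. p x) = 0 then 1 else 2 * (\<Sum>x\<in>S. p x))"

lemma mass_S: "0 \<le> (\<Sum>x\<in>S. p x)" "(\<Sum>x\<in>S. p x) \<le> 1"
  using sum_mono2[of UNIV S p] sum_p marg_nonneg(1) by (auto intro: sum_nonneg)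

lemma eff_scale_bounds: "0 < eff_scale" "eff_scale \<le> 2"
  unfolding eff_scale_def using mass_S by auto

text \<open>Expanding the square leaves two equal diagonal terms and a cross term, which is the
  squared modulus of the mean and so vanishes.\<close>

lemma ieff_eq_variance:
  assumes "\<And>x. x \<notin> S \<Longrightarrow> \<psi> x = 0" "(\<Sum>x\<in>UNIV. of_real (p x) * \<psi> x) = 0"
  shows "ieff p S \<psi> = 2 * (\<Sum>x\<in>S. p x) * (\<Sum>x\<in>UNIV. p x * (cmod (\<psi> x))\<^sup>2)"
proof -
  have on_S: "(\<Sum>x\<in>UNIV. p x * (cmod (\<psi> x))\<^sup>2) = (\<Sum>x\<in>S. p x * (cmod (\<psi> x))\<^sup>2)"
    by (rule sum.mono_neutral_right) (auto simp: assms(1))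
  have "(\<Sum>x\<in>UNIV. of_real (p x) * \<psi> x) = (\<Sum>x\<in>S. of_real (p x) * \<psi> x)"
    by (rule sum.mono_neutral_right) (auto simp: assms(1))
  with assms(2) have mean: "(\<Sum>x\<in>S. of_real (p x) * \<psi> x) = 0" by simp
  have "ieff p S \<psi> = (\<Sum>x\<in>S. \<Sum>x'\<in>S. p x * p x' * (cmod (\<psi> x - \<psi> x'))\<^sup>2)"
    unfolding ieff_def by (rule sum.mono_neutral_cong_right) (auto intro!: sum.mono_neutral_cong_right)
  also have "\<dots> = (\<Sum>x\<in>S. \<Sum>x'\<in>S. (p x * (cmod (\<psi> x))\<^sup>2) * p x') + (\<Sum>x\<in>S. \<Sum>x'\<in>S. p x * (p x' * (cmod (\<psi> x'))\<^sup>2))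
      - 2 * Re (\<Sum>x\<in>S. \<Sum>x'\<in>S. (of_real (p x) * \<psi> x) * cnj (of_real (p x') * \<psi> x'))"
    unfolding cmod_diff_sq Re_sum sum_distrib_left sum.distrib[symmetric] sum_subtractf[symmetric]
    by (intro sum.cong refl) (simp add: algebra_simps)
  also have "\<dots> = 2 * (\<Sum>x\<in>S. p x) * (\<Sum>x\<in>UNIV. p x * (cmod (\<psi> x))\<^sup>2)"
    unfolding sum_product[symmetric] cnj_sum[symmetric] mean on_S by simp
  finally show ?thesis .
qed

text \<open>Elements of \<open>B1\<close> are constant on \<open>S\<close> and cancel in every
  difference that counts; the rest has mean zero and is supported on \<open>S\<close>, so variance
  and Parseval apply.\<close>

lemma ieff_basis_expansion:
  assumes basis: "eff_basis p S B1 B2"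
  shows "ieff p S (\<lambda>x. \<Sum>b\<in>B1 \<union> B2. u b * b x) = eff_scale * (\<Sum>b\<in>B2. (cmod (u b))\<^sup>2)"
proof -
  define \<psi> where "\<psi> x = (\<Sum>b\<in>B2. u b * b x)" for x
  have fin: "finite (B1 \<union> B2)" by (rule finite_B[OF basis])
  \<comment> \<open>Removing \<open>B2\<close> from the union, instead of summing over
    \<open>B1\<close>, gives a disjoint splitting at once.\<close>
  have split: "(\<Sum>b\<in>B1 \<union> B2. u b * b x) = (\<Sum>b\<in>(B1 \<union> B2) - B2. u b * b x) + \<psi> x" for x
    unfolding \<psi>_def using sum.subset_diff[of B2 "B1 \<union> B2"] fin by blast
  have "(\<Sum>b\<in>B1 \<union> B2. u b * b x) - (\<Sum>b\<in>B1 \<union> B2. u b * b x') = \<psi> x - \<psi> x'" if "x \<in> S" "x' \<in> S" for x x'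
  proof -
    have "(\<Sum>b\<in>(B1 \<union> B2) - B2. u b * b x) = (\<Sum>b\<in>(B1 \<union> B2) - B2. u b * b x')"
      using that by (intro sum.cong refl) (auto simp: B1_const[OF basis, of _ x x'])
    then show ?thesis unfolding split by simp
  qed
  then have "ieff p S (\<lambda>x. \<Sum>b\<in>B1 \<union> B2. u b * b x) = ieff p S \<psi>"
    unfolding ieff_def by (intro sum.cong refl) auto
  also have "\<dots> = 2 * (\<Sum>x\<in>S. p x) * (\<Sum>x\<in>UNIV. p x * (cmod (\<psi> x))\<^sup>2)"
  proof (rule ieff_eq_variance)
    show "\<psi> x = 0" if "x \<notin> S" for x
      unfolding \<psi>_def using B2_supp[OF basis _ that] by (intro sum.neutral) auto
    have "(\<Sum>x\<in>UNIV. of_real (p x) * \<psi> x) = (\<Sum>b\<in>B2. u b * (\<Sum>x\<in>UNIV. of_real (p x) * b x))"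
      unfolding \<psi>_def sum_distrib_left by (subst sum.swap) (simp add: mult_ac)
    then show "(\<Sum>x\<in>UNIV. of_real (p x) * \<psi> x) = 0" using B2_mean[OF basis] by simp
  qed
  also have "\<dots> = 2 * (\<Sum>x\<in>S. p x) * (\<Sum>b\<in>B2. (cmod (u b))\<^sup>2)"
    unfolding \<psi>_def parseval[OF finite_B(2)[OF basis] orthonormal_B(2)[OF basis]] ..
  also have "\<dots> = eff_scale * (\<Sum>b\<in>B2. (cmod (u b))\<^sup>2)"
  proof (cases "(\<Sum>x\<in>S. p x) = 0")
    case True
    have "B2 = {}"
    proof (rule ccontr)
      assume "B2 \<noteq> {}"
      then obtain b where b: "b \<in> B2" by blast
      have "p x = 0" if "x \<in> S" for x
        using True that sum_nonneg_eq_0_iff[of S p] marg_nonneg(1) by simp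
      then have "ipx p b b = 0"
        unfolding ipx_def using B2_supp[OF basis b] by (intro sum.neutral) (metis mult_zero_left mult_zero_right of_real_0)
      then show False using orthonormal_B(2)[OF basis] b unfolding orthonormal_fam_def by simp
    qed
    then show ?thesis by simp
  qed (simp add: eff_scale_def)
  finally show ?thesis .
qed

lemma veff_eq_sum_ieff: "veff m S I (\<lambda>_. 1) f = (\<Sum>i\<in>I. ieff m S (\<lambda>x. f x i))" if "finite I"
proof -
  have "(\<Sum>i\<in>I. ieff m S (\<lambda>x. f x i)) = (\<Sum>x\<in>UNIV. \<Sum>i\<in>I. \<Sum>x'\<in>UNIV. if x \<in> S \<and> x' \<in> S then m x * m x' * (cmod (f x i - f x' i))\<^sup>2 else 0)"
    unfolding ieff_def by (rule sum.swap)
  also have "\<dots> = (\<Sum>x\<in>UNIV. \<Sum>x'\<in>UNIV. \<Sum>i\<in>I. if x \<in> S \<and> x' \<in> S then m x * m x' * (cmod (f x i - f x' i))\<^sup>2 else 0)"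
    by (intro sum.cong refl sum.swap)
  also have "\<dots> = veff m S I (\<lambda>_. 1) f"
    unfolding veff_def wsq_def by (intro sum.cong refl) (auto simp: sum_distrib_left)
  finally show ?thesis by simp
qed

subsection \<open>Induction on the dimension\<close>

context
  fixes B1 B2 :: "('a \<Rightarrow> complex) set"
  assumes basis: "eff_basis p S B1 B2"
begin

text \<open>A lower bound on the degree, not an exact value: removing one coordinate lowers the
  degree by 0 or 1, so all slices lie in the class with bound \<open>d - 1\<close>.\<close>

definition highdeg :: "nat \<Rightarrow> nat \<Rightarrow> ('a \<Rightarrow> complex) list set" where
  "highdeg n d = {ch \<in> words (B1 \<union> B2) n. d \<le> effdeg B2 ch}"

text \<open>The induction runs on coefficient vectors, whose Euclidean norm stands in for the norm
  of \<open>F\<close> by Parseval.\<close>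

definition contracts :: "nat \<Rightarrow> nat \<Rightarrow> real \<Rightarrow> bool" where
  "contracts n d D \<longleftrightarrow> (\<forall>u G H. cmod (\<Sum>ch\<in>highdeg n d. u ch * corr \<mu> n (tensor ch) G H T)
     \<le> D * sqrt (\<Sum>ch\<in>highdeg n d. (cmod (u ch))\<^sup>2) * nrm q n G * nrm r n H)"

lemma finite_highdeg: "finite (highdeg n d)"
  unfolding highdeg_def by (rule finite_subset[OF _ finite_words[OF finite_B(1)[OF basis], of n]]) auto

lemma nrm_marg_nonneg: "0 \<le> nrm q n G" "0 \<le> nrm r n H"
  unfolding nrm_eq_sqrt by (auto intro!: real_sqrt_ge_zero wsq_nonneg prod_list_nonneg marg_nonneg)

lemma nrm_marg_sq: "(nrm q n G)\<^sup>2 = L2sq q n G" "(nrm r n H)\<^sup>2 = L2sq r n H"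
  unfolding nrm_eq_sqrt by (auto intro!: real_sqrt_pow2 wsq_nonneg prod_list_nonneg marg_nonneg)

lemma contracts_mono: "contracts n d D \<Longrightarrow> D \<le> D' \<Longrightarrow> contracts n d D'"
  unfolding contracts_def
  by (blast intro: order_trans mult_right_mono nrm_marg_nonneg real_sqrt_ge_zero sum_nonneg zero_le_power2)

lemma contracts_0: "contracts 0 d 1"
  unfolding contracts_def
proof (intro allI)
  fix u G H
  have W: "words (B1 \<union> B2) 0 = {[]}" by auto
  have n: "nrm q 0 G = cmod (G [])" "nrm r 0 H = cmod (H [])"
    by (simp_all add: nrm_def)
  have "highdeg 0 d = {[]} \<or> highdeg 0 d = {}" unfolding highdeg_def W by auto
  moreover have c: "corr \<mu> 0 (tensor []) G H T = G [] * H []" unfolding corr_def by (simp add: tensor_def)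
  ultimately show "cmod (\<Sum>ch\<in>highdeg 0 d. u ch * corr \<mu> 0 (tensor ch) G H T)
     \<le> 1 * sqrt (\<Sum>ch\<in>highdeg 0 d. (cmod (u ch))\<^sup>2) * nrm q 0 G * nrm r 0 H"
    unfolding n by (elim disjE) (simp_all add: c norm_mult mult.assoc)
qed

text \<open>Testing the bound on \<open>u = cnj Q(G,H)\<close> turns the trilinear estimate into an operator bound
  for the vector of correlations with the basis tensors.\<close>

lemma contracts_dual:
  assumes "contracts n d D" "0 < D"
  shows "(\<Sum>ch\<in>highdeg n d. (cmod (corr \<mu> n (tensor ch) G H T))\<^sup>2) \<le> D\<^sup>2 * (L2sq q n G * L2sq r n H)"
proof -
  define W where "W = (\<Sum>ch\<in>highdeg n d. (cmod (corr \<mu> n (tensor ch) G H T))\<^sup>2)"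
  have W0: "0 \<le> W" unfolding W_def by (intro sum_nonneg) auto
  have "(\<Sum>ch\<in>highdeg n d. cnj (corr \<mu> n (tensor ch) G H T) * corr \<mu> n (tensor ch) G H T) = of_real W"
    unfolding W_def of_real_sum complex_norm_square by (simp add: mult.commute)
  then have "cmod (of_real W) \<le> D * sqrt W * nrm q n G * nrm r n H"
    using assms(1)[unfolded contracts_def, rule_format, of "\<lambda>ch. cnj (corr \<mu> n (tensor ch) G H T)" G H]
    by (simp add: W_def)
  then have le: "sqrt W * sqrt W \<le> sqrt W * (D * nrm q n G * nrm r n H)" using W0 by (simp add: mult_ac)
  have "sqrt W \<le> D * nrm q n G * nrm r n H"
  proof (cases "W = 0")
    case True
    then show ?thesis using assms(2) nrm_marg_nonneg by simp
  next
    case False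
    with W0 have "sqrt W > 0" by simp
    then show ?thesis using le by (simp only: mult_le_cancel_left_pos)
  qed
  then have "(sqrt W)\<^sup>2 \<le> (D * nrm q n G * nrm r n H)\<^sup>2" using W0 by (intro power_mono) auto
  then show ?thesis using W0 unfolding W_def[symmetric] by (simp add: power_mult_distrib nrm_marg_sq mult.assoc)
qed

text \<open>Summed over all \<open>Suc n\<close> coordinates, the right-hand sides count each
  squared coefficient with its effective degree, which is at least \<open>d\<close>; some coordinate
  reaches the average.\<close>

lemma exists_influential_coordinate:
  fixes u :: "('a \<Rightarrow> complex) list \<Rightarrow> complex"
  shows "\<exists>i\<le>n. real d / real (Suc n) * (\<Sum>ch\<in>highdeg (Suc n) d. (cmod (u ch))\<^sup>2)
     \<le> (\<Sum>ch\<in>highdeg (Suc n) d. if ch ! i \<in> B2 then (cmod (u ch))\<^sup>2 else 0)"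
proof (rule ccontr)
  let ?X = "highdeg (Suc n) d"
  let ?U = "\<Sum>ch\<in>?X. (cmod (u ch))\<^sup>2"
  let ?w = "\<lambda>i. \<Sum>ch\<in>?X. if ch ! i \<in> B2 then (cmod (u ch))\<^sup>2 else 0"
  assume none: "\<not> ?thesis"
  have "?w i < real d / real (Suc n) * ?U" if "i \<in> {..<Suc n}" for i
  proof -
    have "i \<le> n" using that by simp
    with none have "\<not> real d / real (Suc n) * ?U \<le> ?w i" by blast
    then show ?thesis by (simp only: not_le)
  qed
  then have "(\<Sum>i<Suc n. ?w i) < (\<Sum>i<Suc n. real d / real (Suc n) * ?U)"
    by (intro sum_strict_mono) auto
  also have "\<dots> = real d * ?U" by (simp del: of_nat_Suc)
  also have "\<dots> \<le> (\<Sum>ch\<in>?X. real (effdeg B2 ch) * (cmod (u ch))\<^sup>2)"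
    unfolding sum_distrib_left by (intro sum_mono mult_right_mono) (auto simp: highdeg_def)
  also have "\<dots> = (\<Sum>ch\<in>?X. \<Sum>i<Suc n. if ch ! i \<in> B2 then (cmod (u ch))\<^sup>2 else 0)"
  proof (intro sum.cong refl)
    fix ch assume "ch \<in> ?X"
    then have "real (effdeg B2 ch) = (\<Sum>i<Suc n. if ch ! i \<in> B2 then 1 else 0)"
      by (subst effdeg_eq_sum[of ch "Suc n"]) (auto simp: highdeg_def of_nat_sum simp del: sum.lessThan_Suc intro!: sum.cong)
    then show "real (effdeg B2 ch) * (cmod (u ch))\<^sup>2 = (\<Sum>i<Suc n. if ch ! i \<in> B2 then (cmod (u ch))\<^sup>2 else 0)"
      by (simp only: sum_distrib_right if_distrib[of "\<lambda>t. t * _"] mult_1 mult_zero_left)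
  qed
  also have "\<dots> = (\<Sum>i<Suc n. ?w i)" by (rule sum.swap)
  finally show False by simp
qed

text \<open>Slice at an influential coordinate. The correlation becomes a one-coordinate correlation
  of vector-valued functions, \<open>contracts_dual\<close> makes the rescaled \<open>Q\<close> a
  contraction, and the influence supplies the parameter \<tau> of
  \<open>vector_base_case\<close>.\<close>

lemma contracts_step:
  assumes ind: "contracts n (d - 1) D" and D: "0 < D"
  shows "contracts (Suc n) d ((1 - (eff_scale * (real d / real (Suc n))) ^ (2 * N) / const\<^sub>2) * D)"
  unfolding contracts_def
proof (intro allI)
  fix u :: "('a \<Rightarrow> complex) list \<Rightarrow> complex" and G :: "'b list \<Rightarrow> complex" and H :: "'c list \<Rightarrow> complex"
  let ?B = "B1 \<union> B2" and ?X = "highdeg (Suc n) d" and ?I = "highdeg n (d - 1)"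
  define U where "U = (\<Sum>ch\<in>?X. (cmod (u ch))\<^sup>2)"
  obtain i where i: "i \<le> n" and infl: "real d / real (Suc n) * U \<le> (\<Sum>ch\<in>?X. if ch ! i \<in> B2 then (cmod (u ch))\<^sup>2 else 0)"
    using exists_influential_coordinate unfolding U_def by blast
  define v where "v ch = (if ch \<in> ?X then u ch else 0)" for ch
  have finB: "finite ?B" and finB2: "finite B2" by (rule finite_B[OF basis])+
  have finI: "finite ?I" by (rule finite_highdeg)
  have sub: "?I \<subseteq> words ?B n" "?X \<subseteq> words ?B (Suc n)" unfolding highdeg_def by auto
  \<comment> \<open>One more letter raises the degree by at most one, so a word of degree below
    \<open>d - 1\<close> never extends to one in \<open>?X\<close>.\<close>
  have v0: "v (ins i b ch) = 0" if "ch \<in> words ?B n - ?I" for b ch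
    using that by (auto simp: v_def highdeg_def effdeg_ins split: if_splits)
  \<comment> \<open>Stated for any summand vanishing at coefficient 0, since it is applied to the
    norm, to the influence and to the correlation.\<close>
  have reindex: "(\<Sum>ch\<in>?X. \<phi> ch (u ch)) = (\<Sum>ch\<in>?I. \<Sum>b\<in>?B. \<phi> (ins i b ch) (v (ins i b ch)))"
    if "\<And>ch. \<phi> ch 0 = 0" for \<phi> :: "('a \<Rightarrow> complex) list \<Rightarrow> complex \<Rightarrow> 'z::comm_monoid_add"
  proof -
    have "(\<Sum>ch\<in>?X. \<phi> ch (u ch)) = (\<Sum>ch\<in>words ?B (Suc n). \<phi> ch (v ch))"
      using sub finite_words[OF finB] by (intro sum.mono_neutral_cong_left) (auto simp: v_def that)
    also have "\<dots> = (\<Sum>ch\<in>words ?B n. \<Sum>b\<in>?B. \<phi> (ins i b ch) (v (ins i b ch)))"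
      unfolding sum_words_ins[OF i] by (rule sum.swap)
    also have "\<dots> = (\<Sum>ch\<in>?I. \<Sum>b\<in>?B. \<phi> (ins i b ch) (v (ins i b ch)))"
      using sub finite_words[OF finB] by (intro sum.mono_neutral_right) (auto simp: v0 that)
    finally show ?thesis .
  qed
  \<comment> \<open>Division by \<open>D\<close> normalizes the operator bound to 1. The conjugate
    in \<open>f\<close> below compensates for the one that \<open>wip\<close> puts on its second
    argument.\<close>
  define Q where "Q G H ch = of_real (1 / D) * corr \<mu> n (tensor ch) G H T" for G H ch
  define f where "f x ch = cnj (\<Sum>b\<in>?B. v (ins i b ch) * b x)" for x ch
  define g where "g y l = G (ins i y l)" for y l
  define h where "h z l = H (ins i z l)" for z l
  have F2: "(\<Sum>x\<in>UNIV. p x * wsq ?I (\<lambda>_. 1) (f x)) = U"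
  proof -
    have "(\<Sum>x\<in>UNIV. p x * wsq ?I (\<lambda>_. 1) (f x)) = (\<Sum>ch\<in>?I. \<Sum>x\<in>UNIV. p x * (cmod (\<Sum>b\<in>?B. v (ins i b ch) * b x))\<^sup>2)"
      unfolding wsq_def f_def sum_distrib_left by (subst sum.swap) (simp del: cnj_sum)
    also have "\<dots> = (\<Sum>ch\<in>?I. \<Sum>b\<in>?B. (cmod (v (ins i b ch)))\<^sup>2)"
      unfolding parseval[OF finB orthonormal_B(1)[OF basis]] ..
    also have "\<dots> = U" unfolding U_def using reindex[of "\<lambda>_ c. (cmod c)\<^sup>2"] by simp
    finally show ?thesis .
  qed
  have veff: "veff p S ?I (\<lambda>_. 1) f = eff_scale * (\<Sum>ch\<in>?X. if ch ! i \<in> B2 then (cmod (u ch))\<^sup>2 else 0)"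
  proof -
    have "veff p S ?I (\<lambda>_. 1) f = (\<Sum>ch\<in>?I. ieff p S (\<lambda>x. \<Sum>b\<in>?B. v (ins i b ch) * b x))"
      unfolding veff_eq_sum_ieff[OF finI] f_def ieff_def complex_cnj_diff[symmetric] complex_mod_cnj ..
    also have "\<dots> = eff_scale * (\<Sum>ch\<in>?I. \<Sum>b\<in>B2. (cmod (v (ins i b ch)))\<^sup>2)"
      unfolding ieff_basis_expansion[OF basis] sum_distrib_left ..
    also have "(\<Sum>ch\<in>?I. \<Sum>b\<in>B2. (cmod (v (ins i b ch)))\<^sup>2) = (\<Sum>ch\<in>?I. \<Sum>b\<in>?B. if ins i b ch ! i \<in> B2 then (cmod (v (ins i b ch)))\<^sup>2 else 0)"
    proof (rule sum.cong[OF refl])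
      fix ch assume "ch \<in> ?I"
      then have "i \<le> length ch" using i by (simp add: highdeg_def)
      then show "(\<Sum>b\<in>B2. (cmod (v (ins i b ch)))\<^sup>2) = (\<Sum>b\<in>?B. if ins i b ch ! i \<in> B2 then (cmod (v (ins i b ch)))\<^sup>2 else 0)"
        using finB by (intro sum.mono_neutral_cong_left) (auto simp: nth_ins)
    qed
    also have "\<dots> = (\<Sum>ch\<in>?X. if ch ! i \<in> B2 then (cmod (u ch))\<^sup>2 else 0)"
      by (rule reindex[of "\<lambda>ch c. if ch ! i \<in> B2 then (cmod c)\<^sup>2 else 0", symmetric]) simp
    finally show ?thesis .
  qed
  have corr_eq: "(\<Sum>(x, y, z)\<in>UNIV. of_real (\<mu> (x, y, z)) * T x y z * wip ?I (\<lambda>_. 1) (Q (g y) (h z)) (f x))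
      = of_real (1 / D) * (\<Sum>ch\<in>?X. u ch * corr \<mu> (Suc n) (tensor ch) G H T)"
  proof -
    have slice: "corr \<mu> (Suc n) (tensor (ins i b ch)) G H T
       = (\<Sum>(x, y, z)\<in>UNIV. of_real (\<mu> (x, y, z)) * T x y z * (b x * corr \<mu> n (tensor ch) (g y) (h z) T))"
      if "ch \<in> ?I" for b ch
    proof -
      have len: "length ch = n" using that by (simp add: highdeg_def)
      have "corr \<mu> n (\<lambda>l. tensor (ins i b ch) (ins i x l)) G' H' T = b x * corr \<mu> n (tensor ch) G' H' T" for x G' H'
        unfolding corr_scale_F[symmetric] unfolding corr_def
        by (intro sum.cong refl) (simp add: tensor_ins len)
      then show ?thesis unfolding corr_ins[OF i] g_def[abs_def] h_def[abs_def] by simp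
    qed
    have "(\<Sum>ch\<in>?X. u ch * corr \<mu> (Suc n) (tensor ch) G H T)
       = (\<Sum>ch\<in>?I. \<Sum>b\<in>?B. v (ins i b ch) * corr \<mu> (Suc n) (tensor (ins i b ch)) G H T)"
      using reindex[of "\<lambda>ch c. c * corr \<mu> (Suc n) (tensor ch) G H T"] by simp
    also have "\<dots> = (\<Sum>ch\<in>?I. \<Sum>b\<in>?B. \<Sum>(x, y, z)\<in>UNIV. of_real (\<mu> (x, y, z)) * T x y z * (corr \<mu> n (tensor ch) (g y) (h z) T * (v (ins i b ch) * b x)))"
      by (intro sum.cong refl) (auto simp: slice sum_distrib_left mult_ac intro!: sum.cong)
    also have "\<dots> = (\<Sum>(x, y, z)\<in>UNIV. \<Sum>ch\<in>?I. \<Sum>b\<in>?B. of_real (\<mu> (x, y, z)) * T x y z * (corr \<mu> n (tensor ch) (g y) (h z) T * (v (ins i b ch) * b x)))"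
      by (simp only: case_prod_unfold sum.swap[of _ UNIV ?B] sum.swap[of _ UNIV ?I])
    also have "\<dots> = (\<Sum>(x, y, z)\<in>UNIV. of_real (\<mu> (x, y, z)) * T x y z * (\<Sum>ch\<in>?I. corr \<mu> n (tensor ch) (g y) (h z) T * cnj (f x ch)))"
      unfolding f_def complex_cnj_cnj sum_distrib_left ..
    finally have "of_real (1 / D) * (\<Sum>ch\<in>?X. u ch * corr \<mu> (Suc n) (tensor ch) G H T)
      = (\<Sum>(x, y, z)\<in>UNIV. of_real (1 / D) * (of_real (\<mu> (x, y, z)) * T x y z * (\<Sum>ch\<in>?I. corr \<mu> n (tensor ch) (g y) (h z) T * cnj (f x ch))))"
      by (simp only: sum_distrib_left case_prod_unfold)
    also have "\<dots> = (\<Sum>(x, y, z)\<in>UNIV. of_real (\<mu> (x, y, z)) * T x y z * wip ?I (\<lambda>_. 1) (Q (g y) (h z)) (f x))"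
      unfolding wip_def Q_def sum_distrib_left by (intro sum.cong refl) (auto simp: mult_ac intro!: sum.cong)
    finally show ?thesis by simp
  qed
  have contr: "wsq ?I (\<lambda>_. 1) (Q G H) \<le> L2sq q n G * L2sq r n H" for G H
  proof -
    have "wsq ?I (\<lambda>_. 1) (Q G H) = (1 / D)\<^sup>2 * (\<Sum>ch\<in>?I. (cmod (corr \<mu> n (tensor ch) G H T))\<^sup>2)"
      unfolding Q_def[abs_def] wsq_scale norm_of_real power2_abs by (simp add: wsq_def)
    also have "\<dots> \<le> (1 / D)\<^sup>2 * (D\<^sup>2 * (L2sq q n G * L2sq r n H))"
      by (intro mult_left_mono contracts_dual[OF ind D]) simp
    finally show ?thesis using D by (simp add: power_divide)
  qed
  let ?\<tau> = "eff_scale * (real d / real (Suc n))"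
  have "cmod (of_real (1 / D) * (\<Sum>ch\<in>?X. u ch * corr \<mu> (Suc n) (tensor ch) G H T))
     \<le> (1 - ?\<tau> ^ (2 * N) / const\<^sub>2) * sqrt (\<Sum>x\<in>UNIV. p x * wsq ?I (\<lambda>_. 1) (f x))
       * sqrt (\<Sum>y\<in>UNIV. q y * L2sq q n (g y)) * sqrt (\<Sum>z\<in>UNIV. r z * L2sq r n (h z))"
    unfolding corr_eq[symmetric]
  proof (rule vector_base_case)
    show "wsq ?I (\<lambda>_. 1) (Q v w) \<le> L2sq q n v * L2sq r n w" for v w by (rule contr)
    show "Q (\<lambda>j. v j + c * v' j) w ch = Q v w ch + c * Q v' w ch" for v v' c w ch
      unfolding Q_def corr_lin_G by (simp add: algebra_simps)
    show "Q v (\<lambda>j. w j + c * w' j) ch = Q v w ch + c * Q v w' ch" for v w w' c ch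
      unfolding Q_def corr_lin_H by (simp add: algebra_simps)
    show "0 \<le> ?\<tau>" using eff_scale_bounds by simp
    show "?\<tau> * (\<Sum>x\<in>UNIV. p x * wsq ?I (\<lambda>_. 1) (f x)) \<le> veff p S ?I (\<lambda>_. 1) f"
      unfolding F2 veff mult.assoc using infl eff_scale_bounds by (intro mult_left_mono) auto
  qed (auto intro!: prod_list_nonneg marg_nonneg)
  then have "cmod (\<Sum>ch\<in>?X. u ch * corr \<mu> (Suc n) (tensor ch) G H T) / D
     \<le> (1 - ?\<tau> ^ (2 * N) / const\<^sub>2) * sqrt U * nrm q (Suc n) G * nrm r (Suc n) H"
    using D unfolding F2 nrm_eq_sqrt L2sq_ins[OF i] g_def[abs_def] h_def[abs_def]
    by (simp only: norm_mult norm_of_real) simp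
  then show "cmod (\<Sum>ch\<in>?X. u ch * corr \<mu> (Suc n) (tensor ch) G H T)
     \<le> (1 - ?\<tau> ^ (2 * N) / const\<^sub>2) * D * sqrt (\<Sum>ch\<in>?X. (cmod (u ch))\<^sup>2) * nrm q (Suc n) G * nrm r (Suc n) H"
    using D unfolding U_def by (simp only: pos_divide_le_eq mult_ac)
qed

text \<open>The trivial bound, from the step with its gain discarded; it starts the quantitative
  iteration.\<close>

lemma contracts_1: "contracts n d 1"
proof (induction n arbitrary: d)
  case 0
  show ?case by (rule contracts_0)
next
  case (Suc n)
  show ?case
    by (rule contracts_mono[OF contracts_step[OF Suc.IH]]) (use const2_pos eff_scale_bounds in auto)
qed

section \<open>Iterating the gain\<close>

definition decay :: "real \<Rightarrow> real" where
  "decay \<theta> = 1 - (eff_scale * \<theta>) ^ (2 * N) / const\<^sub>2"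

text \<open>\<open>contracts_step\<close> divides by the bound already obtained, so the powers of
  \<open>decay\<close> must be positive.\<close>

lemma decay_pos:
  assumes "0 \<le> \<theta>" "\<theta> \<le> 1"
  shows "0 < decay \<theta>"
proof -
  have "eff_scale * \<theta> \<le> 2 * 1" using assms eff_scale_bounds by (intro mult_mono) auto
  then have "(eff_scale * \<theta>) ^ (2 * N) \<le> 2 ^ (2 * N)"
    using assms eff_scale_bounds by (intro power_mono) auto
  also have "(2::real) ^ (2 * N) = 4 ^ N" by (simp add: power_mult)
  also have "(4::real) ^ N < 2 * 4 ^ N" by simp
  also have "\<dots> \<le> const\<^sub>2" by (rule const2_ge)
  finally show ?thesis unfolding decay_def using const2_pos by simp
qed

text \<open>Start from the trivial bound in dimension \<open>n\<close> and insert \<open>k\<close>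
  coordinates. By \<open>ratio\<close> each one has degree ratio at least \<theta>, and
  \<open>decay\<close> is decreasing there, so each step gains at least
  \<open>decay \<theta>\<close>.\<close>

lemma contracts_iterate:
  assumes \<theta>: "0 \<le> \<theta>" "\<theta> \<le> 1"
    and ratio: "\<And>j. 1 \<le> j \<Longrightarrow> j \<le> k \<Longrightarrow> \<theta> * real (n + j) \<le> real (d + j)"
  shows "contracts (n + k) (d + k) (decay \<theta> ^ k)"
  using ratio
proof (induction k)
  case 0
  show ?case using contracts_1 by simp
next
  case (Suc k)
  have pos: "0 < decay \<theta> ^ k" using decay_pos[OF \<theta>] by simp
  have "contracts (n + k) (Suc (d + k) - 1) (decay \<theta> ^ k)" using Suc by simp
  from contracts_step[OF this pos]
  have step: "contracts (Suc (n + k)) (Suc (d + k)) (decay (real (Suc (d + k)) / real (Suc (n + k))) * decay \<theta> ^ k)"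
    unfolding decay_def .
  have "\<theta> \<le> real (Suc (d + k)) / real (Suc (n + k))"
    using Suc.prems[of "Suc k"] by (simp add: pos_le_divide_eq)
  then have "eff_scale * \<theta> \<le> eff_scale * (real (Suc (d + k)) / real (Suc (n + k)))"
    using eff_scale_bounds by (intro mult_left_mono) auto
  then have "decay (real (Suc (d + k)) / real (Suc (n + k))) \<le> decay \<theta>"
    unfolding decay_def using \<theta> eff_scale_bounds const2_pos
    by (intro diff_left_mono divide_right_mono power_mono) auto
  then have "decay (real (Suc (d + k)) / real (Suc (n + k))) * decay \<theta> ^ k \<le> decay \<theta> ^ Suc k"
    using pos by simp
  from contracts_mono[OF step this] show ?case by simp
qed

section \<open>From coefficient vectors to functions\<close>

lemma mu_word_pos:
  assumes "prod_list (map \<mu> w) \<noteq> 0" "x \<in> set (map fst w)"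
  shows "p x > 0"
proof -
  obtain y z where "(x, y, z) \<in> set w" using assms(2) by auto
  then have "\<mu> (x, y, z) \<noteq> 0" using assms(1) by (metis image_eqI list.set_map prod_list_zero_iff)
  then show ?thesis using mu_nonneg[of "(x, y, z)"] mu_le_marg(1)[of x y z] by linarith
qed

text \<open>The expansion of \<open>F\<close> holds only on words whose letters have positive mass;
  all other words have weight zero in both the correlation and the norm.\<close>

lemma contracts_eff_homog:
  assumes con: "contracts n d D" and hom: "eff_homog p B1 B2 n d F"
  shows "cmod (corr \<mu> n F G H T) \<le> D * nrm p n F * nrm q n G * nrm r n H"
proof -
  let ?B = "B1 \<union> B2"
  let ?Y = "{ch. length ch = n \<and> set ch \<subseteq> ?B \<and> effdeg B2 ch = d}"
  obtain a where a: "\<And>xs. length xs = n \<Longrightarrow> (\<forall>x\<in>set xs. p x > 0) \<Longrightarrow> F xs = (\<Sum>ch\<in>?Y. a ch * tensor ch xs)"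
    using hom unfolding eff_homog_def by blast
  \<comment> \<open>Extension by zero places exact degree \<open>d\<close> inside the class of
    degree at least \<open>d\<close>, and inside all words, where Parseval applies.\<close>
  define u where "u ch = (if ch \<in> ?Y then a ch else 0)" for ch
  have fin: "finite (words ?B n)" by (rule finite_words[OF finite_B(1)[OF basis]])
  have YX: "?Y \<subseteq> highdeg n d" "highdeg n d \<subseteq> words ?B n" unfolding highdeg_def by auto
  have expand: "(\<Sum>ch\<in>?Y. \<phi> ch (a ch)) = (\<Sum>ch\<in>highdeg n d. \<phi> ch (u ch))"
    "(\<Sum>ch\<in>?Y. \<phi> ch (a ch)) = (\<Sum>ch\<in>words ?B n. \<phi> ch (u ch))"
    if z: "\<And>ch. \<phi> ch 0 = 0" for \<phi> :: "('a \<Rightarrow> complex) list \<Rightarrow> complex \<Rightarrow> 'z::comm_monoid_add"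
  proof -
    have u0: "\<phi> ch (u ch) = 0" if "ch \<notin> ?Y" for ch unfolding u_def by (subst if_not_P[OF that]) (rule z)
    have ua: "\<phi> ch (a ch) = \<phi> ch (u ch)" if "ch \<in> ?Y" for ch unfolding u_def by (simp only: if_P[OF that])
    show "(\<Sum>ch\<in>?Y. \<phi> ch (a ch)) = (\<Sum>ch\<in>highdeg n d. \<phi> ch (u ch))"
      by (rule sum.mono_neutral_cong_left[OF finite_highdeg YX(1)]) (use u0 ua in blast)+
    show "(\<Sum>ch\<in>?Y. \<phi> ch (a ch)) = (\<Sum>ch\<in>words ?B n. \<phi> ch (u ch))"
      by (rule sum.mono_neutral_cong_left[OF fin order_trans[OF YX]]) (use u0 ua in blast)+
  qed
  have F: "F xs = (\<Sum>ch\<in>words ?B n. u ch * tensor ch xs)" if "length xs = n" "\<forall>x\<in>set xs. p x > 0" for xs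
    using a[OF that] expand(2)[of "\<lambda>ch c. c * tensor ch xs"] by simp
  have "corr \<mu> n F G H T = corr \<mu> n (\<lambda>xs. \<Sum>ch\<in>words ?B n. u ch * tensor ch xs) G H T"
    unfolding corr_def
  proof (rule sum.cong[OF refl])
    fix w :: "('a \<times> 'b \<times> 'c) list" assume "w \<in> {w. length w = n}"
    then have "F (map fst w) = (\<Sum>ch\<in>words ?B n. u ch * tensor ch (map fst w))" if "prod_list (map \<mu> w) \<noteq> 0"
      using mu_word_pos[OF that] by (intro F) auto
    then show "complex_of_real (prod_list (map \<mu> w)) * F (map fst w) * G (map (fst \<circ> snd) w)
        * H (map (snd \<circ> snd) w) * prod_list (map (\<lambda>(x, y, z). T x y z) w)
      = complex_of_real (prod_list (map \<mu> w)) * (\<Sum>ch\<in>words ?B n. u ch * tensor ch (map fst w)) * G (map (fst \<circ> snd) w)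
        * H (map (snd \<circ> snd) w) * prod_list (map (\<lambda>(x, y, z). T x y z) w)"
      by (cases "prod_list (map \<mu> w) = 0") (simp_all only: of_real_0 mult_zero_left not_False_eq_True)
  qed
  also have "\<dots> = (\<Sum>ch\<in>highdeg n d. u ch * corr \<mu> n (tensor ch) G H T)"
    unfolding corr_lin_F using expand[of "\<lambda>ch c. c * corr \<mu> n (tensor ch) G H T"] by simp
  finally have corr: "corr \<mu> n F G H T = (\<Sum>ch\<in>highdeg n d. u ch * corr \<mu> n (tensor ch) G H T)" .
  have "L2sq p n F = L2sq p n (\<lambda>xs. \<Sum>ch\<in>words ?B n. u ch * tensor ch xs)"
    unfolding wsq_def
  proof (rule sum.cong[OF refl])
    fix xs :: "'a list" assume len: "xs \<in> {xs. length xs = n}"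
    have "F xs = (\<Sum>ch\<in>words ?B n. u ch * tensor ch xs)" if "prod_list (map p xs) \<noteq> 0"
    proof (rule F)
      show "\<forall>x\<in>set xs. p x > 0"
        using that marg_nonneg(1) by (auto simp: prod_list_zero_iff less_le)
    qed (use len in simp)
    then show "prod_list (map p xs) * (cmod (F xs))\<^sup>2
      = prod_list (map p xs) * (cmod (\<Sum>ch\<in>words ?B n. u ch * tensor ch xs))\<^sup>2"
      by (cases "prod_list (map p xs) = 0") (simp_all only: mult_zero_left not_False_eq_True)
  qed
  also have "\<dots> = (\<Sum>ch\<in>words ?B n. (cmod (u ch))\<^sup>2)"
    by (rule parseval_tensor[OF finite_B(1)[OF basis] orthonormal_B(1)[OF basis]])
  also have "\<dots> = (\<Sum>ch\<in>highdeg n d. (cmod (u ch))\<^sup>2)"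
    using expand[of "\<lambda>_ c. (cmod c)\<^sup>2"] by simp
  finally have "nrm p n F = sqrt (\<Sum>ch\<in>highdeg n d. (cmod (u ch))\<^sup>2)" unfolding nrm_eq_sqrt by simp
  then show ?thesis using con unfolding contracts_def corr by simp
qed

text \<open>Uses \<open>1 - s \<le> exp (- s)\<close>, at least \<open>d / 2\<close> steps, and
  \<open>ln 2 \<le> 1\<close> to change the base. One factor 1/2 in the constant comes from the
  number of steps, the one inside the power from \<theta> being \<open>d / (2 * n)\<close>.\<close>

lemma decay_power_le:
  fixes n d :: nat
  assumes "0 < d" "d \<le> n"
  shows "decay (real d / (2 * real n)) ^ (d - d div 2)
    \<le> 2 powr (- ((eff_scale / 2) ^ (2 * N) / (2 * const\<^sub>2) * real d * (real d / real n) powr real (2 * N)))"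
proof -
  define s where "s = (eff_scale * (real d / (2 * real n))) ^ (2 * N) / const\<^sub>2"
  define k where "k = d - d div 2"
  have s0: "0 \<le> s" unfolding s_def using eff_scale_bounds const2_pos by simp
  have "decay (real d / (2 * real n)) \<le> exp (- s)"
    unfolding decay_def s_def using exp_ge_add_one_self[of "- s"] by (simp add: s_def)
  moreover have "0 \<le> decay (real d / (2 * real n))"
    using assms by (intro less_imp_le decay_pos) auto
  ultimately have "decay (real d / (2 * real n)) ^ k \<le> exp (- s) ^ k" by (intro power_mono)
  also have "\<dots> = exp (- (s * real k))" by (simp add: exp_of_nat_mult[symmetric] mult_ac)
  also have "\<dots> \<le> exp (- (s * (real d / 2)))"
  proof -
    have "real d / 2 \<le> real k" unfolding k_def by linarith
    from mult_left_mono[OF this s0] show ?thesis by simp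
  qed
  also have "\<dots> \<le> 2 powr (- (s * (real d / 2)))"
  proof -
    have "ln 2 * (s * (real d / 2)) \<le> 1 * (s * (real d / 2))"
      using s0 ln_le_minus_one[of 2] by (intro mult_right_mono) auto
    then show ?thesis by (simp add: powr_def mult_ac)
  qed
  also have "s * (real d / 2) = (eff_scale / 2) ^ (2 * N) / (2 * const\<^sub>2) * real d * (real d / real n) powr real (2 * N)"
  proof -
    have "(real d / real n) powr real (2 * N) = (real d / real n) ^ (2 * N)"
      using assms by (intro powr_realpow) auto
    moreover have "(eff_scale * (real d / (2 * real n))) ^ (2 * N) = (eff_scale / 2) ^ (2 * N) * (real d / real n) ^ (2 * N)"
      unfolding power_mult_distrib[symmetric] by simp
    ultimately show ?thesis unfolding s_def by (simp only:) (simp add: mult_ac)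
  qed
  finally show ?thesis unfolding k_def .
qed

lemma eff_homog_corr_bound:
  assumes hom: "eff_homog p B1 B2 n d F"
  shows "cmod (corr \<mu> n F G H T)
    \<le> 2 powr (- ((eff_scale / 2) ^ (2 * N) / (2 * const\<^sub>2) * real d * (real d / real n) powr real (2 * N)))
      * nrm p n F * nrm q n G * nrm r n H"
proof -
  let ?e = "2 powr (- ((eff_scale / 2) ^ (2 * N) / (2 * const\<^sub>2) * real d * (real d / real n) powr real (2 * N)))"
  have "contracts n d ?e"
  \<comment> \<open>For \<open>d = 0\<close> the exponent is zero whatever the quotient is,
    including the case \<open>n = 0\<close>, and the trivial bound suffices.\<close>
  proof (cases "d = 0")
    case True
    then show ?thesis using contracts_1 by simp
  next
    case False
    show ?thesis
    proof (cases "d \<le> n")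
      case True
      \<comment> \<open>Half of the degree, rounded up. While these coordinates are inserted the
        degree stays at least \<open>d / 2\<close> and the dimension at most \<open>n\<close>, so
        the ratio is at least \<open>d / (2 * n)\<close>.\<close>
      let ?k = "d - d div 2"
      have "contracts (n - ?k + ?k) (d div 2 + ?k) (decay (real d / (2 * real n)) ^ ?k)"
      proof (rule contracts_iterate)
        fix j assume j: "1 \<le> j" "j \<le> ?k"
        have "real d / (2 * real n) * real (n - ?k + j) \<le> real d / (2 * real n) * real n"
          using True j by (intro mult_left_mono) auto
        also have "\<dots> = real d / 2" using True False by simp
        \<comment> \<open>For odd \<open>d\<close>, \<open>1 \<le> j\<close> makes up for the
          rounding in \<open>d div 2\<close>.\<close>
        also have "\<dots> \<le> real (d div 2 + j)" using j by linarith
        finally show "real d / (2 * real n) * real (n - ?k + j) \<le> real (d div 2 + j)" .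
      qed (use True False in auto)
      moreover have "n - ?k + ?k = n" "d div 2 + ?k = d" using True by auto
      ultimately have "contracts n d (decay (real d / (2 * real n)) ^ ?k)" by simp
      then show ?thesis using decay_power_le[of d n] True False by (elim contracts_mono) auto
    next
      case False
      \<comment> \<open>No word is long enough to have degree \<open>d > n\<close>, so the sum is
        empty.\<close>
      have "effdeg B2 ch \<le> length ch" for ch unfolding effdeg_filter by simp
      then have "highdeg n d = {}" unfolding highdeg_def using False by (auto dest: le_trans)
      then show ?thesis unfolding contracts_def using nrm_marg_nonneg by simp
    qed
  qed
  from contracts_eff_homog[OF this hom] show ?thesis .
qed

end

end

section \<open>Choice of the constants\<close>

theorem theorem4p12:
  fixes \<mu> :: "'a::finite \<times> 'b::finite \<times> 'c::finite \<Rightarrow> real"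
    and S :: "'a set"
    and T :: "'a \<Rightarrow> 'b \<Rightarrow> 'c \<Rightarrow> complex"
  assumes "\<forall>t. \<mu> t \<ge> 0"
    and "(\<Sum>t\<in>UNIV. \<mu> t) = 1"
    and "\<forall>x y z. (x, y, z) \<in> supp \<mu> \<longrightarrow> cmod (T x y z) \<le> 1"
    and "nonembeddable \<mu> T"
    and "relaxed_base_case \<mu> S T"
  shows "\<exists>c>0. \<exists>C>0. \<forall>B1 B2. eff_basis (margx \<mu>) S B1 B2 \<longrightarrow>
    (\<forall>(n::nat) (d::nat) F G H. eff_homog (margx \<mu>) B1 B2 n d F \<longrightarrow>
       cmod (corr \<mu> n F G H T)
         \<le> 2 powr (- (c * real d * (real d / real n) powr C))
            * nrm (margx \<mu>) n F * nrm (margy \<mu>) n G * nrm (margz \<mu>) n H)"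
proof -
  let ?N = "100 * max CARD('a) (max CARD('b) CARD('c))"
  have indep: "\<And>y z. margyz \<mu> y z = margy \<mu> y * margz \<mu> z"
    using assms(5) unfolding relaxed_base_case_def by (elim conjE) simp
  obtain c0 where c0: "c0 > 0" and base: "\<forall>\<tau>>0. \<forall>f g h. ieff (margx \<mu>) S f \<ge> \<tau> * (nrm1 (margx \<mu>) f)\<^sup>2 \<longrightarrow>
        cmod (corr1 \<mu> f g h T) \<le> (1 - c0 * \<tau> ^ ?N) * nrm1 (margx \<mu>) f * nrm1 (margy \<mu>) g * nrm1 (margz \<mu>) h"
    using assms(5) unfolding relaxed_base_case_def by (elim conjE exE) (rule that)
  \<comment> \<open>The support is finite, so the sum of all reciprocal masses dominates each of
    them.\<close>
  define A where "A = (\<Sum>t\<in>supp \<mu>. 1 / \<mu> t)"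
  have A: "1 \<le> A * \<mu> t" if "\<mu> t > 0" for t
  proof -
    have "1 / \<mu> t \<le> A"
      unfolding A_def using that by (intro member_le_sum) (auto simp: supp_def)
    then show ?thesis using that by (simp add: field_simps)
  qed
  have N: "?N > 0" by (simp add: less_max_iff_disj)
  interpret relaxed_base \<mu> S T ?N c0 A
  proof
    show "0 \<le> \<mu> t" for t using assms(1) by blast
    show "cmod (T x y z) \<le> 1" if "\<mu> (x, y, z) > 0" for x y z
      using assms(3) that by (simp add: supp_def)
  qed (use assms(2) indep N c0 A base in blast)+
  \<comment> \<open>Built from \<mu>, \<open>S\<close> and the base-case constants only, hence the
    same for all bases and dimensions. The exponent \<open>C\<close> is
    \<open>2 * ?N\<close>.\<close>
  let ?c = "(eff_scale / 2) ^ (2 * ?N) / (2 * const\<^sub>2)"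
  have "?c > 0" using eff_scale_bounds const2_pos by simp
  moreover have "real (2 * ?N) > 0" using N by simp
  ultimately show ?thesis using eff_homog_corr_bound by blast
qed

end
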